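(* Let $p$ be a complex polynomial of degree $d \geq 2$ such that $H_p = p^{-1}(H_p) = K_p$ and this set has nonempty interior, where $H_p=\operatorname{conv}J_p$. Then $p$ is affinely conjugate to a monomial $cz^d$ with $|c|=1$; that is, there exist $a\in\mathbb{C}\setminus\{0\}$, $b\in\mathbb{C}$ and $c\in\mathbb{C}$ with $|c|=1$ such that, with $g(z)=az+b$, one has $p(z) = g^{-1}\big(c\,(g(z))^d\big)$ for all $z\in\mathbb{C}$.
   Context: For a polynomial $p$ viewed as a holomorphic self-map of the Riemann sphere $\widehat{\mathbb{C}}$ (with $p(\infty)=\infty$), the Fatou set $F_p$ is the maximal open subset of $\widehat{\mathbb{C}}$ on which the iterates $\{p^{\circ n}\}_{n\in\mathbb{N}}$ form an equicontinuous family, and the Julia set $J_p$ is the complement $\widehat{\mathbb{C}}\setminus F_p$. The filled-in Julia set is $K_p=\{z\in\mathbb{C} : \{p^{\circ n}(z)\}_{n\ge 0} \text{ is bounded}\}$. $\operatorname{conv} X$ denotes the convex hull of $X \subset \mathbb{C}\cong\mathbb{R}^2$. *)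

theory Defs
  imports "HOL-Analysis.Analysis" "HOL-Computational_Algebra.Polynomial"
begin

definition chordal :: "complex \<Rightarrow> complex \<Rightarrow> real" where
  "chordal z w = 2 * cmod (z - w) / (sqrt (1 + (cmod z)\<^sup>2) * sqrt (1 + (cmod w)\<^sup>2))"

text \<open>The iterates of a polynomial map form an equicontinuous family on U
  (source: Euclidean metric, locally equivalent to the spherical one on C;
   target: chordal metric of the Riemann sphere).\<close>
definition iter_equicontinuous_on :: "complex poly \<Rightarrow> complex set \<Rightarrow> bool" where
  "iter_equicontinuous_on p U \<longleftrightarrow>
     (\<forall>z\<in>U. \<forall>\<epsilon>>0. \<exists>\<delta>>0. \<forall>w\<in>U. cmod (w - z) < \<delta> \<longrightarrow>
        (\<forall>n::nat. chordal (((poly p) ^^ n) w) (((poly p) ^^ n) z) < \<epsilon>))"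

text \<open>Finite part of the Fatou set: the union of all open sets on which the iterates are
  equicontinuous (= the maximal such open set, intersected with C).\<close>
definition fatou_set :: "complex poly \<Rightarrow> complex set" where
  "fatou_set p = \<Union>{U. open U \<and> iter_equicontinuous_on p U}"

definition julia_set :: "complex poly \<Rightarrow> complex set" where
  "julia_set p = UNIV - fatou_set p"

definition filled_julia_set :: "complex poly \<Rightarrow> complex set" where
  "filled_julia_set p = {z. bounded (range (\<lambda>n. ((poly p) ^^ n) z))}"

end

theory Submission
  imports Defs "HOL-Complex_Analysis.Complex_Analysis"
    "HOL-Computational_Algebra.Fundamental_Theorem_Algebra"
begin

text \<open>Let \<open>K\<close> be the convex filled Julia set and \<open>U\<close> its interior. By the Schwarz lemma \<open>p\<close> has a
  fixed point \<open>z0\<close> on the boundary of \<open>K\<close>; since \<open>K\<close> lies in a half plane at \<open>z0\<close>, the multiplier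
  \<open>m\<close> is real, and it exceeds 1. The linearization \<open>F (m z) = p (F z)\<close> is therefore entire, and
  \<open>F\<^sup>-\<^sup>1 U\<close> is the tangent cone of \<open>U\<close> at \<open>z0\<close>. By Picard's theorem \<open>F\<close> takes the value \<open>z0\<close> at some
  \<open>s \<noteq> 0\<close>, and comparing the cone with \<open>U\<close> near \<open>s\<close> shows that the cone is a half plane. On the
  complementary half plane \<open>log (B \<circ> F)\<close>, with \<open>B\<close> the Boettcher function, has real part 0 on the
  boundary line, hence extends by reflection to an entire function that is homogeneous under \<open>m\<close>;
  so it is linear, \<open>m\<close> is the degree of \<open>p\<close>, and injectivity of \<open>B\<close> near infinity makes \<open>F\<close>
  periodic. Thus \<open>F\<close> is an entire function of an exponential, of linear growth in it, hence affine
  in it, and \<open>p\<close> is conjugate to a power.\<close>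


subsection \<open>Filled Julia sets\<close>

text \<open>Nothing is known at the start about the smoothness of the boundary of \<open>K\<close>.
  Convexity only says that the tangent cone at \<open>z0\<close> has an angle of at most pi. The
  second preimage \<open>s\<close> of \<open>z0\<close> under \<open>F\<close> turns this into
  equality: at \<open>s\<close>, a nonzero boundary point, the cone looks like a half plane, and
  \<open>F - z0\<close> multiplies angles at \<open>s\<close> by the order of its zero there, so
  \<open>U\<close> cannot have an angle below pi at \<open>z0\<close>. The straight boundary is what
  makes reflection available. Convexity is used once more to make the Boettcher function
  single-valued on the whole complement of \<open>U\<close> and continuous up to the boundary. The
  equations \<open>F (m z) = p (F z)\<close> and \<open>B (p w) = B w ^ d\<close> combine to
  \<open>L (m z) = d * L z\<close> for a normalized logarithm \<open>L\<close> of
  \<open>B \<circ> F\<close>. A Taylor coefficient of order \<open>n\<close> can survive only if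
  \<open>m ^ n = d\<close>, and the sign of the real part on the half plane leaves
  \<open>n = 1\<close>.\<close>

lemma poly_escape_radius:
  fixes p :: "complex poly"
  assumes "degree p \<ge> 2"
  obtains R where "R > 0" "\<And>z. R \<le> cmod z \<Longrightarrow> 2 * cmod z \<le> cmod (poly p z)"
proof -
  obtain a q where pq: "p = pCons a q" by (cases p) auto
  with assms have dq: "degree q \<ge> 1" by (auto split: if_splits)
  obtain b r where qr: "q = pCons b r" by (cases q) auto
  have "r \<noteq> 0" using dq qr by auto
  \<comment> \<open>The bound 3 pays for the constant term: \<open>3 * |z| - |a|\<close> is at least
    \<open>2 * |z|\<close> once \<open>|z| \<ge> |a|\<close>.\<close>
  from poly_infinity[OF this, of 3 b] obtain s where s: "\<And>z. s \<le> cmod z \<Longrightarrow> 3 \<le> cmod (poly q z)"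
    unfolding qr by blast
  show thesis
  proof (rule that[of "max 1 (max s (cmod a))"])
    fix z assume "max 1 (max s (cmod a)) \<le> cmod z"
    then have z: "1 \<le> cmod z" "s \<le> cmod z" "cmod a \<le> cmod z" by auto
    have "3 * cmod z \<le> cmod (z * poly q z)"
      using s[OF z(2)] by (simp add: norm_mult mult.commute mult_left_mono)
    moreover have "cmod (z * poly q z) - cmod a \<le> cmod (poly p z)"
      using norm_diff_ineq[of "z * poly q z" a] by (simp add: pq add.commute)
    ultimately show "2 * cmod z \<le> cmod (poly p z)" using z by linarith
  qed simp
qed

lemma escape_radius_funpow:
  fixes f :: "complex \<Rightarrow> complex"
  assumes "R > 0" "\<And>z. R \<le> cmod z \<Longrightarrow> 2 * cmod z \<le> cmod (f z)" "R \<le> cmod z"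
  shows "2 ^ n * cmod z \<le> cmod ((f ^^ n) z)"
proof (induction n)
  case (Suc n)
  have "cmod z \<le> 2 ^ n * cmod z" by (simp add: mult_le_cancel_right1)
  then have "R \<le> cmod ((f ^^ n) z)" using assms(3) Suc by linarith
  from assms(2)[OF this] Suc show ?case by simp
qed simp

lemma escape_radius_unbounded:
  fixes f :: "complex \<Rightarrow> complex"
  assumes "R > 0" "\<And>z. R \<le> cmod z \<Longrightarrow> 2 * cmod z \<le> cmod (f z)"
    and bd: "bounded (range (\<lambda>n. (f ^^ n) z))"
  shows "cmod z < R"
proof (rule ccontr)
  assume "\<not> cmod z < R"
  then have z: "R \<le> cmod z" by simp
  obtain B where B: "\<And>n. cmod ((f ^^ n) z) \<le> B"
    using bd unfolding bounded_iff by auto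
  obtain n where "B / cmod z < 2 ^ n"
    using real_arch_pow[of 2 "B / cmod z"] by auto
  moreover have "cmod z > 0" using z assms(1) by linarith
  ultimately have "B < 2 ^ n * cmod z" by (simp add: field_simps)
  with escape_radius_funpow[OF assms(1,2) z, of n] B[of n] show False by linarith
qed

lemma bounded_orbit_step:
  fixes f :: "'a::metric_space \<Rightarrow> 'a"
  shows "bounded (range (\<lambda>n. (f ^^ n) (f z))) \<longleftrightarrow> bounded (range (\<lambda>n. (f ^^ n) z))"
proof -
  have "range (\<lambda>n. (f ^^ n) z) = insert z (range (\<lambda>n. (f ^^ n) (f z)))"
  proof (intro set_eqI iffI)
    fix x assume "x \<in> range (\<lambda>n. (f ^^ n) z)"
    then obtain n where "x = (f ^^ n) z" by auto
    then show "x \<in> insert z (range (\<lambda>n. (f ^^ n) (f z)))"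
      by (cases n) (auto simp: funpow_swap1 simp del: funpow.simps(2) simp add: funpow_Suc_right)
  next
    fix x assume "x \<in> insert z (range (\<lambda>n. (f ^^ n) (f z)))"
    then consider "x = (f ^^ 0) z" | n where "x = (f ^^ Suc n) z"
      by (auto simp: funpow_Suc_right simp del: funpow.simps(2))
    then show "x \<in> range (\<lambda>n. (f ^^ n) z)" by cases blast+
  qed
  then show ?thesis by simp
qed

text \<open>The escape radius makes boundedness uniform: a bounded orbit never leaves the disc of
  radius \<open>R\<close>. The set is therefore an intersection of closed conditions, one for each
  iterate.\<close>

lemma compact_filled_julia_set:
  assumes "degree p \<ge> 2"
  shows "compact (filled_julia_set p)"
proof -
  obtain R where R: "R > 0" "\<And>z. R \<le> cmod z \<Longrightarrow> 2 * cmod z \<le> cmod (poly p z)"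
    using poly_escape_radius[OF assms] by blast
  have eq: "filled_julia_set p = (\<Inter>n. {z. cmod ((poly p ^^ n) z) \<le> R})"
  proof (intro set_eqI iffI)
    fix z assume z: "z \<in> filled_julia_set p"
    have "cmod ((poly p ^^ n) z) < R" for n
    proof (rule escape_radius_unbounded[OF R])
      have "(poly p ^^ k) ((poly p ^^ n) z) = (poly p ^^ (k + n)) z" for k
        by (simp add: funpow_add)
      then have "range (\<lambda>k. (poly p ^^ k) ((poly p ^^ n) z)) \<subseteq> range (\<lambda>k. (poly p ^^ k) z)" by auto
      then show "bounded (range (\<lambda>k. (poly p ^^ k) ((poly p ^^ n) z)))"
        using z bounded_subset by (auto simp: filled_julia_set_def)
    qed
    then show "z \<in> (\<Inter>n. {z. cmod ((poly p ^^ n) z) \<le> R})" by (auto intro: less_imp_le)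
  next
    fix z assume "z \<in> (\<Inter>n. {z. cmod ((poly p ^^ n) z) \<le> R})"
    then show "z \<in> filled_julia_set p" by (auto simp: filled_julia_set_def bounded_iff)
  qed
  have cont: "continuous_on UNIV (poly p ^^ n)" for n
    by (induction n) (auto intro!: continuous_intros continuous_on_compose simp: o_def)
  have "closed (filled_julia_set p)" unfolding eq
    by (intro closed_INT ballI closed_Collect_le continuous_intros cont)
  moreover have "bounded (filled_julia_set p)"
    unfolding eq bounded_iff by (rule exI[of _ R]) (auto, metis funpow_0)
  ultimately show ?thesis by (simp add: compact_eq_bounded_closed)
qed

subsection \<open>Convex filled Julia sets\<close>

locale convex_filled_julia =
  fixes p :: "complex poly" and K :: "complex set"
  assumes degree_ge_2: "degree p \<ge> 2"
    and K_eq: "K = filled_julia_set p"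
    and convex_K: "convex K"
    and interior_K: "interior K \<noteq> {}"
begin

abbreviation "f \<equiv> poly p"
abbreviation "U \<equiv> interior K"

lemma compact_K: "compact K" and closed_K: "closed K" and bounded_K: "bounded K"
  using compact_filled_julia_set[OF degree_ge_2] by (auto simp: K_eq compact_eq_bounded_closed)

lemma orbit_in_K: "z \<in> K" if "bounded (range (\<lambda>n. (f ^^ n) z))"
  using that by (simp add: K_eq filled_julia_set_def)

lemma orbit_bounded_in_K: "z \<in> K" if "\<And>n. cmod ((f ^^ n) z) \<le> B"
  using that by (intro orbit_in_K) (auto simp: bounded_iff)

lemma f_in_K_iff [simp]: "f z \<in> K \<longleftrightarrow> z \<in> K"
  by (simp add: K_eq filled_julia_set_def bounded_orbit_step)

lemma funpow_in_K_iff [simp]: "(f ^^ n) z \<in> K \<longleftrightarrow> z \<in> K"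
  by (induction n) auto

lemma open_U: "open U" and convex_U: "convex U" and U_subset_K: "U \<subseteq> K"
  by (auto simp: convex_K interior_subset)

lemma not_constant_f: "\<not> f constant_on UNIV"
proof
  assume "f constant_on UNIV"
  then obtain c where "\<And>z. f z = c" by (auto simp: constant_on_def)
  then have "poly p = poly [:c:]" by auto
  then have "p = [:c:]" by (simp only: poly_eq_poly_eq_iff)
  with degree_ge_2 show False by simp
qed

lemma holomorphic_f [holomorphic_intros]:
  "g holomorphic_on A \<Longrightarrow> (\<lambda>z. f (g z)) holomorphic_on A"
  by (induction p) (auto intro!: holomorphic_intros)

lemma open_image_f: "open A \<Longrightarrow> open (f ` A)"
  by (rule open_mapping_thm[of f UNIV]) (auto intro!: holomorphic_intros not_constant_f)

text \<open>Complete invariance passes from \<open>K\<close> to its interior: preimages of open sets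
  are open by continuity, images by the open mapping theorem.\<close>

lemma f_in_U_iff [simp]: "f z \<in> U \<longleftrightarrow> z \<in> U"
proof
  assume "f z \<in> U"
  then have "z \<in> f -` U" by simp
  moreover have "open (f -` U)"
    by (intro open_vimage) (auto intro!: continuous_intros)
  moreover have "f -` U \<subseteq> K" using interior_subset by force
  ultimately show "z \<in> U" by (meson interiorI)
next
  assume "z \<in> U"
  then have "f z \<in> f ` U" by simp
  moreover have "f ` U \<subseteq> K" using interior_subset by force
  ultimately show "f z \<in> U" using open_image_f[OF open_U] by (meson interiorI)
qed

lemma funpow_in_U_iff [simp]: "(f ^^ n) z \<in> U \<longleftrightarrow> z \<in> U"
  by (induction n) auto

lemma K_bounded: obtains B where "B > 0" "\<And>z. z \<in> K \<Longrightarrow> cmod z \<le> B"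
  using bounded_K unfolding bounded_pos by auto

end

subsection \<open>A fixed point on the boundary\<close>

text \<open>This is the equality case of the Schwarz lemma, carried to \<open>U\<close> by a Riemann
  map that sends \<open>a\<close> to 0. The conjugated map \<open>h\<close> is then a rotation, and
  either a second fixed point or the derivative 1 makes the rotation trivial.\<close>

lemma holomorphic_self_map_eq_id:
  fixes f :: "complex \<Rightarrow> complex"
  assumes U: "open U" "simply_connected U" "U \<noteq> UNIV"
    and holf: "f holomorphic_on U" and fU: "f ` U \<subseteq> U"
    and a: "a \<in> U" "f a = a"
    and alt: "(\<exists>b\<in>U. b \<noteq> a \<and> f b = b) \<or> deriv f a = 1"
    and z: "z \<in> U"
  shows "f z = z"
proof -
  let ?D = "ball (0::complex) 1"
  have "\<exists>\<phi> \<psi>. \<phi> holomorphic_on U \<and> \<psi> holomorphic_on ?D \<and>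
          (\<forall>z\<in>U. \<phi> z \<in> ?D \<and> \<psi> (\<phi> z) = z) \<and> (\<forall>z\<in>?D. \<psi> z \<in> U \<and> \<phi> (\<psi> z) = z)"
    using Riemann_mapping_theorem[of U] U a by auto
  then obtain \<phi>0 \<psi>0 where R: "\<phi>0 holomorphic_on U" "\<psi>0 holomorphic_on ?D"
      "\<And>z. z \<in> U \<Longrightarrow> \<phi>0 z \<in> ?D" "\<And>z. z \<in> U \<Longrightarrow> \<psi>0 (\<phi>0 z) = z"
      "\<And>z. z \<in> ?D \<Longrightarrow> \<psi>0 z \<in> U" "\<And>z. z \<in> ?D \<Longrightarrow> \<phi>0 (\<psi>0 z) = z"
    by blast
  \<comment> \<open>The Riemann map need not send \<open>a\<close> to 0; the disc automorphism
    \<open>M\<close>, with inverse \<open>N\<close>, corrects this.\<close>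
  obtain M N where MN: "M (\<phi>0 a) = 0" "M holomorphic_on ?D" "M ` ?D \<subseteq> ?D"
      "N holomorphic_on ?D" "N ` ?D \<subseteq> ?D"
      "\<And>z. z \<in> ?D \<Longrightarrow> M (N z) = z" "\<And>z. z \<in> ?D \<Longrightarrow> N (M z) = z"
    using ball_biholomorphism_exists[OF R(3)[OF a(1)]] by metis
  define \<phi> where "\<phi> = M \<circ> \<phi>0"
  define \<psi> where "\<psi> = \<psi>0 \<circ> N"
  have \<phi>D: "\<phi> z \<in> ?D" and \<psi>\<phi>: "\<psi> (\<phi> z) = z" if "z \<in> U" for z
    using R(3,4)[OF that] MN(3,7) by (auto simp: \<phi>_def \<psi>_def image_subset_iff)
  have \<psi>U: "\<psi> z \<in> U" and \<phi>\<psi>: "\<phi> (\<psi> z) = z" if "z \<in> ?D" for z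
    using R(5,6) MN(5,6) that by (auto simp: \<phi>_def \<psi>_def image_subset_iff)
  have hol\<phi>: "\<phi> holomorphic_on U" unfolding \<phi>_def
    using R(3) by (intro holomorphic_on_compose_gen[OF R(1) MN(2)]) auto
  have hol\<psi>: "\<psi> holomorphic_on ?D" unfolding \<psi>_def
    using MN(5) by (intro holomorphic_on_compose_gen[OF MN(4) R(2)]) auto
  have \<phi>a: "\<phi> a = 0" by (simp add: \<phi>_def MN)
  have \<psi>0: "\<psi> 0 = a" using \<psi>\<phi>[OF a(1)] \<phi>a by simp
  define h where "h = \<phi> \<circ> f \<circ> \<psi>"
  have "f \<circ> \<psi> holomorphic_on ?D"
    using \<psi>U by (intro holomorphic_on_compose_gen[OF hol\<psi> holf]) auto
  then have "\<phi> \<circ> (f \<circ> \<psi>) holomorphic_on ?D"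
    by (rule holomorphic_on_compose_gen[OF _ hol\<phi>]) (use \<psi>U fU in auto)
  then have holh: "h holomorphic_on ?D" by (simp add: h_def o_assoc)
  have h1: "cmod (h w) < 1" if "cmod w < 1" for w
    using \<phi>D[of "f (\<psi> w)"] \<psi>U[of w] fU that by (auto simp: h_def image_subset_iff)
  have h0: "h 0 = 0" by (simp add: h_def \<psi>0 a \<phi>a)
  have dh: "deriv h 0 = 1" if "deriv f a = 1"
  proof -
    have d\<psi>: "(\<psi> has_field_derivative deriv \<psi> 0) (at 0)"
      using hol\<psi> by (intro holomorphic_derivI[of _ ?D]) auto
    have d\<phi>: "(\<phi> has_field_derivative deriv \<phi> a) (at a)"
      using hol\<phi> U a by (intro holomorphic_derivI[of _ U]) auto
    have df: "(f has_field_derivative 1) (at a)"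
      using holomorphic_derivI[OF holf U(1) a(1)] that by simp
    have "((\<lambda>w. \<phi> (\<psi> w)) has_field_derivative deriv \<phi> a * deriv \<psi> 0) (at 0)"
      using DERIV_chain2[of \<phi> _ \<psi> 0] d\<phi> d\<psi> \<psi>0 by auto
    then have "((\<lambda>w. w) has_field_derivative deriv \<phi> a * deriv \<psi> 0) (at 0)"
      by (rule has_field_derivative_transform_within_open[of _ _ _ ?D]) (auto simp: \<phi>\<psi>)
    then have 1: "deriv \<phi> a * deriv \<psi> 0 = 1"
      using DERIV_unique DERIV_ident by blast
    have "((\<lambda>w. f (\<psi> w)) has_field_derivative 1 * deriv \<psi> 0) (at 0)"
      using DERIV_chain2[of f 1 \<psi> 0] df d\<psi> \<psi>0 by auto
    then have "((\<lambda>w. \<phi> (f (\<psi> w))) has_field_derivative deriv \<phi> a * (1 * deriv \<psi> 0)) (at 0)"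
      using DERIV_chain2[of \<phi> _ "\<lambda>w. f (\<psi> w)" 0] d\<phi> \<psi>0 a by auto
    then show ?thesis using 1 by (auto intro: DERIV_imp_deriv simp: h_def o_def)
  qed
  have bh: "\<exists>w. cmod w < 1 \<and> w \<noteq> 0 \<and> h w = w" if b: "b \<in> U" "b \<noteq> a" "f b = b" for b
    using \<phi>D[OF b(1)] \<psi>\<phi>[OF b(1)] b \<psi>0
    by (intro exI[of _ "\<phi> b"]) (auto simp: h_def)
  have "(\<exists>w. cmod w < 1 \<and> w \<noteq> 0 \<and> cmod (h w) = cmod w) \<or> cmod (deriv h 0) = 1"
    using alt bh dh by (metis norm_one)
  from Schwarz_Lemma(3)[OF holh h0 h1 _ this, of 0]
  obtain \<alpha> where \<alpha>: "\<And>w. cmod w < 1 \<Longrightarrow> h w = \<alpha> * w" by auto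
  have "\<alpha> = 1"
  proof (cases "deriv f a = 1")
    case True
    have "((\<lambda>w. \<alpha> * w) has_field_derivative \<alpha>) (at 0)"
      by (auto intro!: derivative_eq_intros)
    then have "(h has_field_derivative \<alpha>) (at 0)"
      by (rule has_field_derivative_transform_within_open[of _ _ _ ?D]) (auto simp: \<alpha>)
    then show ?thesis using dh[OF True] DERIV_imp_deriv by force
  next
    case False
    with alt bh obtain w where "cmod w < 1" "w \<noteq> 0" "h w = w" by blast
    with \<alpha>[of w] show ?thesis by simp
  qed
  then have "h (\<phi> z) = \<phi> z" using \<phi>D[OF z] \<alpha> by simp
  then have "\<phi> (f z) = \<phi> z" by (simp add: h_def \<psi>\<phi>[OF z])
  then have "\<psi> (\<phi> (f z)) = \<psi> (\<phi> z)" by simp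
  then show ?thesis using \<psi>\<phi> z fU by (auto simp: image_subset_iff)
qed

text \<open>If \<open>u \<noteq> 1\<close>, the geometric sums of \<open>u ^ n\<close> are bounded.
  So \<open>Re (v * u ^ n)\<close> is a nonnegative sequence with bounded partial sums and tends to
  0 for every \<open>v\<close> in \<open>T\<close>. As \<open>T\<close> is open, the same holds for
  the imaginary parts, which contradicts that \<open>v * u ^ n\<close> has constant modulus.\<close>

lemma rotation_in_half_plane_trivial:
  fixes u :: complex
  assumes u: "cmod u = 1" and T: "open T" "T \<noteq> {}"
    and pos: "\<And>v n. v \<in> T \<Longrightarrow> 0 \<le> Re (v * u ^ n)"
  shows "u = 1"
proof (rule ccontr)
  assume u1: "u \<noteq> 1"
  have lim: "(\<lambda>n. Re (v * u ^ n)) \<longlonglongrightarrow> 0" if v: "v \<in> T" for v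
  proof (rule summable_LIMSEQ_zero, rule bounded_imp_summable)
    fix n
    have "(\<Sum>k\<le>n. Re (v * u ^ k)) = Re (v * (\<Sum>k\<le>n. u ^ k))"
      by (simp add: sum_distrib_left)
    also have "(\<Sum>k\<le>n. u ^ k) = (1 - u ^ Suc n) / (1 - u)"
      using u1 by (subst sum_gp0) auto
    also have "Re (v * ((1 - u ^ Suc n) / (1 - u))) \<le> cmod (v * ((1 - u ^ Suc n) / (1 - u)))"
      by (rule complex_Re_le_cmod)
    also have "\<dots> \<le> cmod v * (2 / cmod (1 - u))"
    proof -
      have "cmod (1 - u ^ Suc n) \<le> 2"
        using norm_triangle_ineq4[of 1 "u ^ Suc n"] by (simp add: norm_mult norm_power u)
      then show ?thesis
        unfolding norm_mult norm_divide by (intro mult_left_mono divide_right_mono) auto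
    qed
    finally show "(\<Sum>k\<le>n. Re (v * u ^ k)) \<le> cmod v * (2 / cmod (1 - u))" .
  qed (use pos v in auto)
  obtain v0 where "v0 \<in> T" using T by blast
  with T(1) obtain r where r: "r > 0" "ball v0 r \<subseteq> T" using open_contains_ball by blast
  \<comment> \<open>The contradiction needs a nonzero element of \<open>T\<close>; if the first
    choice is 0, a nearby point replaces it.\<close>
  define v where "v = (if v0 = 0 then complex_of_real (r / 2) else v0)"
  have v: "v \<in> T" "v \<noteq> 0" using r \<open>v0 \<in> T\<close> by (auto simp: v_def dist_norm intro!: subsetD[OF r(2)])
  from T(1) v obtain s where s: "s > 0" "ball v s \<subseteq> T" using open_contains_ball by blast
  define \<epsilon> where "\<epsilon> = s / (2 * cmod v)"
  have \<epsilon>: "\<epsilon> > 0" using s v by (simp add: \<epsilon>_def)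
  \<comment> \<open>Multiplying by \<open>1 + \<i> * \<epsilon>\<close> changes the real part of
    \<open>v * u ^ n\<close> by \<open>-\<epsilon>\<close> times its imaginary part, so two limits
    of real parts control the imaginary part.\<close>
  have w: "v + v * (\<i> * \<epsilon>) \<in> T"
    using s v by (intro subsetD[OF s(2)]) (auto simp: dist_norm norm_mult norm_divide \<epsilon>_def)
  have "(\<lambda>n. (Re (v * u ^ n) - Re ((v + v * (\<i> * \<epsilon>)) * u ^ n)) / \<epsilon>) \<longlonglongrightarrow> (0 - 0) / \<epsilon>"
    using \<epsilon> by (intro tendsto_intros lim v w) auto
  moreover have "(Re (v * u ^ n) - Re ((v + v * (\<i> * \<epsilon>)) * u ^ n)) / \<epsilon> = Im (v * u ^ n)" for n
    using \<epsilon> by (simp add: field_simps)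
  ultimately have "(\<lambda>n. Im (v * u ^ n)) \<longlonglongrightarrow> 0" by simp
  with lim[OF v(1)] have "(\<lambda>n. v * u ^ n) \<longlonglongrightarrow> 0"
    by (simp only: tendsto_complex_iff zero_complex.sel)
  then have "(\<lambda>n. cmod (v * u ^ n)) \<longlonglongrightarrow> cmod 0" by (rule tendsto_norm)
  then have "(\<lambda>n::nat. cmod v) \<longlonglongrightarrow> 0" by (simp add: norm_mult norm_power u)
  then show False using v by (simp add: LIMSEQ_const_iff)
qed

context convex_filled_julia
begin

lemma fixed_point_in_K: "f z = z \<Longrightarrow> z \<in> K"
proof (rule orbit_bounded_in_K[of _ "cmod z"])
  fix n assume "f z = z"
  then have "(f ^^ n) z = z" by (induction n) auto
  then show "cmod ((f ^^ n) z) \<le> cmod z" by simp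
qed

text \<open>The fixed points are the roots of \<open>q\<close>, of which there are at least two with
  multiplicity, and their constant orbits put them in \<open>K\<close>. If all were in
  \<open>U\<close>, there would be either two distinct ones or a double one, where the multiplier is
  1. Both make \<open>f\<close> the identity on \<open>U\<close>, and then \<open>q\<close> has
  infinitely many roots.\<close>

lemma frontier_fixed_point:
  obtains z0 where "z0 \<in> K" "z0 \<notin> U" "f z0 = z0"
proof (rule ccontr)
  assume "\<not> thesis"
  then have fixU: "f z = z \<Longrightarrow> z \<in> U" for z using that fixed_point_in_K by blast
  define q where "q = p - [:0, 1:]"
  have fq: "poly q z = f z - z" for z by (simp add: q_def)
  have "degree q = degree p"
    using degree_add_eq_left[of "- [:0, 1:]" p] degree_ge_2 by (simp add: q_def del: minus_pCons)
  then have dq: "degree q \<ge> 2" using degree_ge_2 by simp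
  then have "\<not> constant (poly q)" by (simp add: constant_degree)
  then obtain a where qa: "poly q a = 0" using fundamental_theorem_of_algebra by blast
  then obtain r where r: "q = [:-a, 1:] * r" using poly_eq_0_iff_dvd by (metis dvdE)
  then have "r \<noteq> 0" using dq by auto
  then have "degree q = Suc (degree r)" unfolding r by (subst degree_mult_eq) auto
  then have "\<not> constant (poly r)" using dq by (simp add: constant_degree)
  then obtain b where rb: "poly r b = 0" using fundamental_theorem_of_algebra by blast
  then have qb: "poly q b = 0" by (simp add: r)
  have aU: "a \<in> U" "f a = a" and bU: "b \<in> U" "f b = b"
    using fixU qa qb fq by auto
  have alt: "(\<exists>b\<in>U. b \<noteq> a \<and> f b = b) \<or> deriv f a = 1"
  proof (cases "b = a")
    case True
    then have "poly (pderiv q) a = 0" using rb unfolding r pderiv_mult by (simp add: pderiv_pCons)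
    then have "poly (pderiv p) a = 1" by (simp add: q_def pderiv_diff pderiv_pCons)
    then show ?thesis using poly_DERIV[of p a] DERIV_imp_deriv by metis
  qed (use bU in blast)
  have "U \<noteq> UNIV" using compact_K U_subset_K not_compact_UNIV by (metis UNIV_I subset_antisym subsetI subset_UNIV)
  have "f z = z" if "z \<in> U" for z
  proof (rule holomorphic_self_map_eq_id[OF open_U _ \<open>U \<noteq> UNIV\<close> _ _ aU alt that])
    show "simply_connected U" using convex_U by (rule convex_imp_simply_connected)
    show "f holomorphic_on U" by (intro holomorphic_intros)
    show "f ` U \<subseteq> U" using f_in_U_iff by blast
  qed
  then have "U \<subseteq> {z. poly q z = 0}" by (auto simp: fq)
  moreover have "finite {z. poly q z = 0}" using dq by (intro poly_roots_finite) auto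
  ultimately have "finite U" using finite_subset by blast
  then show False using open_U interior_K finite_imp_not_open by blast
qed

end

subsection \<open>The multiplier is real and greater than one\<close>

text \<open>Two nonzero vectors that are not opposite have a bisector, and both make an acute angle
  with it.\<close>

lemma common_half_plane:
  fixes x \<kappa> :: complex
  assumes "x * cnj \<kappa> \<notin> \<real>\<^sub>\<le>\<^sub>0"
  obtains \<omega> where "Re (\<omega> * x) > 0" "Re (\<omega> * \<kappa>) > 0"
proof -
  have nz: "x \<noteq> 0" "\<kappa> \<noteq> 0" using assms by auto
  have "- cmod (x * cnj \<kappa>) \<noteq> Re (x * cnj \<kappa>)"
  proof
    assume eq: "- cmod (x * cnj \<kappa>) = Re (x * cnj \<kappa>)"
    then have "(Re (x * cnj \<kappa>))\<^sup>2 = (cmod (x * cnj \<kappa>))\<^sup>2" by (metis power2_minus)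
    then have "Im (x * cnj \<kappa>) = 0" unfolding cmod_power2 by simp
    moreover have "Re (x * cnj \<kappa>) \<le> 0" using eq norm_ge_zero[of "x * cnj \<kappa>"] by linarith
    ultimately show False using assms by (simp add: complex_nonpos_Reals_iff)
  qed
  moreover have "- cmod (x * cnj \<kappa>) \<le> Re (x * cnj \<kappa>)"
    using abs_Re_le_cmod[of "x * cnj \<kappa>"] by linarith
  ultimately have lt: "0 < cmod x * cmod \<kappa> + Re (x * cnj \<kappa>)" by (simp add: norm_mult)
  \<comment> \<open>The conjugate of the bisector: up to the factor \<open>|x| * |\<kappa>|\<close>
    it is the conjugate of the sum of the two unit vectors.\<close>
  define \<omega> where "\<omega> = cnj x * cmod \<kappa> + cnj \<kappa> * cmod x"
  have "\<omega> * x = (cmod x * cmod x) * cmod \<kappa> + (x * cnj \<kappa>) * cmod x"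
    using complex_norm_square[of x] by (simp add: \<omega>_def algebra_simps power2_eq_square)
  then have 1: "Re (\<omega> * x) = cmod x * (cmod x * cmod \<kappa> + Re (x * cnj \<kappa>))"
    by (simp add: algebra_simps)
  have "\<omega> * \<kappa> = (cmod \<kappa> * cmod \<kappa>) * cmod x + cnj (x * cnj \<kappa>) * cmod \<kappa>"
    using complex_norm_square[of \<kappa>] by (simp add: \<omega>_def algebra_simps power2_eq_square)
  then have 2: "Re (\<omega> * \<kappa>) = cmod \<kappa> * (cmod x * cmod \<kappa> + Re (x * cnj \<kappa>))"
    by (simp add: algebra_simps)
  show thesis
  proof (rule that[of \<omega>])
    show "0 < Re (\<omega> * x)" unfolding 1 using lt nz by (intro mult_pos_pos) auto
    show "0 < Re (\<omega> * \<kappa>)" unfolding 2 using lt nz by (intro mult_pos_pos) auto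
  qed
qed

context convex_filled_julia
begin

lemma closure_U: "closure U = K"
  using convex_closure_interior[OF convex_K interior_K] closed_K by simp

lemma segment_in_U:
  assumes "z0 \<in> K" "z \<in> U" "0 < t" "t \<le> (1::real)"
  shows "z0 + t * (z - z0) \<in> U"
  using mem_interior_convex_shrink[OF convex_K assms(2,1,3,4)]
  by (simp add: scaleR_conv_of_real algebra_simps)

lemma supporting_line:
  assumes "z0 \<notin> U"
  obtains e where "e \<noteq> 0" "\<And>z. z \<in> K \<Longrightarrow> 0 \<le> Re (e * (z - z0))"
    "\<And>z. z \<in> U \<Longrightarrow> 0 < Re (e * (z - z0))"
proof -
  obtain a b where ab: "a \<noteq> 0" "a \<bullet> z0 \<le> b" "\<And>x. x \<in> U \<Longrightarrow> b \<le> a \<bullet> x"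
    using separating_hyperplane_sets[of "{z0}" U] convex_U interior_K assms by auto
  have inner: "Re (cnj a * (z - z0)) = a \<bullet> z - a \<bullet> z0" for z
    by (simp add: inner_complex_def algebra_simps)
  have U0: "0 \<le> Re (cnj a * (z - z0))" if "z \<in> U" for z
    using ab(2) ab(3)[OF that] by (simp only: inner)
  show thesis
  proof (rule that[of "cnj a"])
    fix z assume "z \<in> K"
    then have "z \<in> closure U" by (simp add: closure_U)
    moreover have "closed {z. 0 \<le> Re (cnj a * (z - z0))}"
      by (intro closed_Collect_le continuous_intros)
    then have "closure U \<subseteq> {z. 0 \<le> Re (cnj a * (z - z0))}"
      by (intro closure_minimal) (use U0 in auto)
    ultimately show "0 \<le> Re (cnj a * (z - z0))" by auto
  next
    fix z assume z: "z \<in> U"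
    then obtain r where r: "r > 0" "ball z r \<subseteq> U" using open_U open_contains_ball by blast
    \<comment> \<open>With this \<open>c\<close> the point \<open>z - a * c\<close> is moved by
      \<open>r / 2\<close> straight towards the line and is still in \<open>U\<close>; hence
      \<open>z\<close> itself is strictly beyond the line.\<close>
    define c where "c = complex_of_real (r / (2 * cmod a))"
    have "z - a * c \<in> U"
      using r ab(1) by (intro subsetD[OF r(2)]) (auto simp: dist_norm norm_mult c_def norm_divide)
    from U0[OF this] have "0 \<le> Re (cnj a * (z - z0)) - Re (cnj a * a * c)"
      by (simp add: algebra_simps)
    also have "cnj a * a * c = complex_of_real ((cmod a)\<^sup>2 * (r / (2 * cmod a)))"
      using complex_norm_square[of a] by (simp add: c_def mult.commute)
    finally have "(cmod a)\<^sup>2 * (r / (2 * cmod a)) \<le> Re (cnj a * (z - z0))" by simp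
    moreover have "(cmod a)\<^sup>2 * (r / (2 * cmod a)) > 0" using ab r by simp
    ultimately show "0 < Re (cnj a * (z - z0))" by linarith
  qed (use ab in simp)
qed

end

locale frontier_fixed_point = convex_filled_julia +
  fixes z0 :: complex
  assumes z0: "z0 \<in> K" "z0 \<notin> U" "f z0 = z0"
begin

definition "m = poly (pderiv p) z0"

lemma DERIV_f_z0: "(f has_field_derivative m) (at z0)"
  by (simp add: m_def)

lemma funpow_z0 [simp]: "(f ^^ n) z0 = z0"
  by (induction n) (auto simp: z0)

lemma DERIV_funpow_z0: "((f ^^ n) has_field_derivative m ^ n) (at z0)"
proof (induction n)
  case (Suc n)
  have "((\<lambda>z. f ((f ^^ n) z)) has_field_derivative m * m ^ n) (at z0)"
    using DERIV_chain2[of f m "f ^^ n" z0] Suc DERIV_f_z0 by auto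
  then show ?case by (simp add: o_def)
qed (simp add: DERIV_ident id_def)

text \<open>An attracting fixed point has a disc around it that \<open>f\<close> maps into itself.
  The orbits there are bounded, so the point would be interior to \<open>K\<close>.\<close>

lemma multiplier_ge_1: "1 \<le> cmod m"
proof (rule ccontr)
  assume "\<not> 1 \<le> cmod m"
  then have m1: "cmod m < 1" by simp
  have "((\<lambda>z. cmod ((f z - f z0) / (z - z0))) \<longlongrightarrow> cmod m) (at z0)"
    using DERIV_f_z0 by (intro tendsto_norm) (simp add: has_field_derivative_iff)
  then have "\<forall>\<^sub>F z in at z0. cmod ((f z - f z0) / (z - z0)) < 1"
    using m1 by (rule order_tendstoD)
  then obtain \<delta> where \<delta>: "\<delta> > 0"
      "\<And>z. z \<noteq> z0 \<Longrightarrow> dist z z0 < \<delta> \<Longrightarrow> cmod ((f z - f z0) / (z - z0)) < 1"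
    unfolding eventually_at by auto
  have step: "cmod (f z - z0) < \<delta>" if "cmod (z - z0) < \<delta>" for z
  proof (cases "z = z0")
    case False
    then show ?thesis using \<delta>(2)[of z] that by (simp add: dist_norm norm_divide z0 divide_simps)
  qed (use that z0 in simp)
  have "ball z0 \<delta> \<subseteq> K"
  proof
    fix z assume "z \<in> ball z0 \<delta>"
    then have "cmod (z - z0) < \<delta>" by (simp add: dist_norm norm_minus_commute)
    then have orb: "cmod ((f ^^ n) z - z0) < \<delta>" for n
      by (induction n) (auto simp: step)
    have "cmod ((f ^^ n) z) \<le> cmod z0 + \<delta>" for n
      using norm_triangle_ineq2[of "(f ^^ n) z" z0] orb[of n] by linarith
    then show "z \<in> K" by (rule orbit_bounded_in_K)
  qed
  then have "z0 \<in> U" using \<delta>(1) by (metis centre_in_ball interiorI open_ball)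
  with z0 show False by simp
qed

text \<open>The segment from \<open>z0\<close> to a point \<open>z\<close> of \<open>U\<close> stays
  in \<open>U\<close> under all iterates, hence on one side of the supporting line. Its image under
  \<open>f ^^ n\<close> leaves \<open>z0\<close> in the direction \<open>m ^ n * (z - z0)\<close>,
  so all powers of the argument of \<open>m\<close> keep an open set of directions in one half
  plane.\<close>

lemma multiplier_pos: "m = complex_of_real (cmod m)"
proof -
  obtain e where e: "e \<noteq> 0" "\<And>z. z \<in> K \<Longrightarrow> 0 \<le> Re (e * (z - z0))"
    using supporting_line[OF z0(2)] by metis
  define u where "u = m / complex_of_real (cmod m)"
  have mpos: "cmod m > 0" using multiplier_ge_1 by linarith
  define T where "T = (\<lambda>z. e * z - e * z0) ` U"
  have "open T"
  proof -
    have "T = (\<lambda>w. w / e + z0) -` U"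
      using e(1) by (auto simp: T_def field_simps image_iff intro!: bexI[of _ "_ / e + z0"])
    then show ?thesis using open_U by (auto intro!: open_vimage continuous_intros simp: e(1))
  qed
  moreover have "T \<noteq> {}" using interior_K by (simp add: T_def)
  moreover have "0 \<le> Re (v * u ^ n)" if "v \<in> T" for v n
  proof -
    from that obtain z where z: "z \<in> U" "v = e * (z - z0)" by (auto simp: T_def algebra_simps)
    have zz: "z \<noteq> z0" using z z0 by auto
    define g where "g = (\<lambda>t::real. ((f ^^ n) (z0 + t * (z - z0)) - z0) / t)"
    have "((\<lambda>w. (f ^^ n) (z0 + w * (z - z0))) has_field_derivative m ^ n * (z - z0)) (at 0)"
      by (rule DERIV_chain2[of "f ^^ n"])
         (use DERIV_funpow_z0[of n] in \<open>auto intro!: derivative_eq_intros\<close>)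
    then have "((\<lambda>w. ((f ^^ n) (z0 + w * (z - z0)) - z0) / w) \<longlongrightarrow> m ^ n * (z - z0)) (at 0)"
      by (simp add: has_field_derivative_iff)
    moreover have "filterlim complex_of_real (at 0) (at_right 0)"
      unfolding filterlim_at
      by (auto intro!: tendsto_eq_intros eventually_at_right_less simp: eventually_at_filter)
    ultimately have "(g \<longlongrightarrow> m ^ n * (z - z0)) (at_right 0)"
      unfolding g_def by (rule filterlim_compose)
    then have "((\<lambda>t. Re (e * g t)) \<longlongrightarrow> Re (e * (m ^ n * (z - z0)))) (at_right 0)"
      by (intro tendsto_intros)
    moreover have "\<forall>\<^sub>F t in at_right 0. 0 \<le> Re (e * g t)"
    proof -
      have "0 \<le> Re (e * g t)" if t: "0 < t" "t < 1" for t
      proof -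
        have "(f ^^ n) (z0 + t * (z - z0)) \<in> U" using segment_in_U[OF z0(1) z(1)] t by simp
        then have "0 \<le> Re (e * ((f ^^ n) (z0 + t * (z - z0)) - z0))"
          using e(2) U_subset_K by blast
        moreover have "e * g t = (e * ((f ^^ n) (z0 + t * (z - z0)) - z0)) / t" by (simp add: g_def)
        ultimately show ?thesis using t by (simp add: Re_divide_of_real)
      qed
      then show ?thesis using eventually_at_right_less eventually_at_right_field by (metis zero_less_one)
    qed
    ultimately have "0 \<le> Re (e * (m ^ n * (z - z0)))"
      by (rule tendsto_lowerbound) simp
    also have "e * (m ^ n * (z - z0)) = (v * u ^ n) * complex_of_real (cmod m ^ n)"
      using mpos by (simp add: z u_def power_divide)
    also have "Re \<dots> = Re (v * u ^ n) * cmod m ^ n" by (simp add: algebra_simps flip: of_real_power)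
    finally have "0 \<le> Re (v * u ^ n) * cmod m ^ n" .
    moreover have "cmod m ^ n > 0" using mpos by (rule zero_less_power)
    ultimately show ?thesis by (metis zero_le_mult_iff not_le)
  qed
  ultimately have "u = 1"
    using rotation_in_half_plane_trivial[of u T] mpos by (auto simp: u_def norm_divide)
  then show ?thesis using mpos by (simp add: u_def)
qed

end

context frontier_fixed_point
begin

text \<open>If the multiplier were 1, then in the coordinate \<open>N = 1 / (z - z0) ^ j\<close> the map would be
  close to a translation by a nonzero \<open>\<kappa>\<close>. The half planes \<open>{Re (\<omega> N) > \<rho>}\<close> with
  \<open>Re (\<omega> \<kappa>) > 0\<close> are then forward invariant, and one of them meets the
  half plane beyond the supporting line of \<open>K\<close> at \<open>z0\<close>.\<close>

lemma multiplier_neq_1: "m \<noteq> 1"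
proof
  assume m1: "m = 1"
  \<comment> \<open>Multiplier 1 means that \<open>Q\<close> vanishes at \<open>z0\<close> to an
    order \<open>k = Suc j\<close> with \<open>j > 0\<close>.\<close>
  define Q where "Q = p - [:0, 1:]"
  have fQ: "f z = z + poly Q z" for z by (simp add: Q_def)
  have "degree Q = degree p"
    using degree_add_eq_left[of "- [:0, 1:]" p] degree_ge_2 by (simp add: Q_def del: minus_pCons)
  then have Q0: "Q \<noteq> 0" using degree_ge_2 by auto
  define k where "k = order z0 Q"
  obtain q where q: "Q = [:- z0, 1:] ^ k * q" "\<not> [:- z0, 1:] dvd q"
    using order_decomp[OF Q0] unfolding k_def by blast
  have q0: "poly q z0 \<noteq> 0" using q(2) by (simp add: poly_eq_0_iff_dvd)
  have Qz0: "poly Q z0 = 0" using fQ[of z0] z0 by simp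
  have "k \<noteq> 0" using q q0 Qz0 by auto
  moreover have "k \<noteq> 1"
  proof
    assume "k = 1"
    then have "poly (pderiv Q) z0 = poly q z0"
      unfolding q(1) pderiv_mult by (simp add: pderiv_pCons)
    moreover have "poly (pderiv Q) z0 = 0"
      using m1 by (simp add: Q_def m_def pderiv_diff pderiv_pCons)
    ultimately show False using q0 by simp
  qed
  ultimately obtain j where j: "k = Suc j" "j > 0" by (cases k) auto
  define s where "s z = (z - z0) ^ j * poly q z" for z
  have fs: "f z - z0 = (z - z0) * (1 + s z)" for z
    unfolding fQ q(1) s_def by (simp add: j algebra_simps)
  have s0: "s z0 = 0" using j by (simp add: s_def)
  define N where "N z = 1 / (z - z0) ^ j" for z
  \<comment> \<open>The increment \<open>N (f z) - N z\<close>, written without the pole at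
    \<open>z0\<close>. Its value \<open>\<kappa>\<close> there is \<open>- j * poly q z0\<close>,
    the approximate translation.\<close>
  define G where "G z = - poly q z * (\<Sum>i<j. (1 + s z) ^ i) / (1 + s z) ^ j" for z
  have Nf: "N (f z) = N z + G z" if z: "z \<noteq> z0" "1 + s z \<noteq> 0" for z
  proof -
    have "(1 + s z) ^ j - 1 = s z * (\<Sum>i<j. (1 + s z) ^ i)"
      using power_diff_1_eq[of "1 + s z" j] by simp
    then have "1 - (1 + s z) ^ j = - ((z - z0) ^ j) * (poly q z * (\<Sum>i<j. (1 + s z) ^ i))"
      unfolding s_def by (simp add: algebra_simps)
    then have *: "poly q z * (\<Sum>i<j. (1 + s z) ^ i) = - (1 - (1 + s z) ^ j) / (z - z0) ^ j"
      using z by simp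
    have "G z = (1 - (1 + s z) ^ j) / (z - z0) ^ j / (1 + s z) ^ j"
      unfolding G_def using * by (simp, metis minus_diff_eq minus_divide_left)
    also have "\<dots> = N (f z) - N z"
      unfolding N_def fs power_mult_distrib using z by (simp add: field_simps)
    finally show ?thesis by simp
  qed
  define \<kappa> where "\<kappa> = G z0"
  have \<kappa>: "\<kappa> \<noteq> 0" using q0 j by (simp add: \<kappa>_def G_def s0)
  obtain e where e: "e \<noteq> 0" "\<And>z. z \<in> K \<Longrightarrow> 0 \<le> Re (e * (z - z0))"
    using supporting_line[OF z0(2)] by metis
  \<comment> \<open>A direction \<open>u\<close> that leaves the supporting half plane cannot lead
    into an invariant half plane of the \<open>N\<close>-coordinate, since the points of the latter
    have bounded orbits and so belong to \<open>K\<close>.\<close>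
  have incompatible: False
    if \<omega>: "Re (\<omega> * \<kappa>) > 0" "Re (\<omega> * (1 / u ^ j)) > 0" and u: "Re (e * u) < 0" for \<omega> u
  proof -
    have \<omega>0: "\<omega> \<noteq> 0" and u0: "u \<noteq> 0" using \<omega> u by auto
    have "isCont (\<lambda>z. Re (\<omega> * G z)) z0" unfolding G_def s_def
      using j by (intro continuous_Re continuous_intros) (auto simp: power_0_left)
    then have "\<forall>\<^sub>F z in at z0. 0 < Re (\<omega> * G z)"
      unfolding isCont_def by (rule order_tendstoD(1)) (use \<omega>(1) \<kappa>_def in simp)
    moreover have "isCont (\<lambda>z. cmod (s z)) z0" unfolding s_def by (intro continuous_intros)
    then have "\<forall>\<^sub>F z in at z0. cmod (s z) < 1"
      unfolding isCont_def by (rule order_tendstoD(2)) (simp add: s0)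
    ultimately have "\<forall>\<^sub>F z in at z0. 0 < Re (\<omega> * G z) \<and> cmod (s z) < 1"
      by (rule eventually_conj)
    then obtain \<delta> where \<delta>: "\<delta> > 0"
        "\<And>z. z \<noteq> z0 \<Longrightarrow> dist z z0 < \<delta> \<Longrightarrow> 0 < Re (\<omega> * G z) \<and> cmod (s z) < 1"
      unfolding eventually_at by auto
    \<comment> \<open>Chosen so that \<open>Re (\<omega> * N z) > \<rho>\<close> forces
      \<open>|z - z0| < \<delta>\<close>, where the increment has positive real part after
      multiplication by \<open>\<omega>\<close>.\<close>
    define \<rho> where "\<rho> = cmod \<omega> / \<delta> ^ j"
    define P where "P = {z. z \<noteq> z0 \<and> Re (\<omega> * N z) > \<rho>}"
    have near: "cmod (z - z0) < \<delta>" if "z \<in> P" for z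
    proof -
      have "\<rho> < cmod (\<omega> * N z)" using that complex_Re_le_cmod[of "\<omega> * N z"] by (simp add: P_def)
      then have "cmod \<omega> * (1 / \<delta> ^ j) < cmod \<omega> * (1 / cmod (z - z0) ^ j)"
        by (simp add: \<rho>_def N_def norm_mult norm_divide norm_power)
      then have "1 / \<delta> ^ j < 1 / cmod (z - z0) ^ j"
        using \<omega>0 by (subst (asm) mult_less_cancel_left_pos) auto
      moreover have "cmod (z - z0) > 0" using that by (simp add: P_def)
      ultimately have "cmod (z - z0) ^ j < \<delta> ^ j"
        using \<delta>(1) by (simp add: frac_less_eq divide_less_eq less_divide_eq mult.commute)
      then show ?thesis using \<delta>(1) by (meson power_less_imp_less_base less_imp_le)
    qed
    have step: "f z \<in> P" if z: "z \<in> P" for z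
    proof -
      have zz: "z \<noteq> z0" "dist z z0 < \<delta>" using near[OF z] z by (auto simp: P_def dist_norm)
      have G: "0 < Re (\<omega> * G z)" "cmod (s z) < 1" using \<delta>(2)[OF zz] by auto
      have s1: "1 + s z \<noteq> 0" using G(2) by (metis add_eq_0_iff norm_minus_cancel norm_one less_irrefl)
      have "f z \<noteq> z0" using fs[of z] zz s1 by auto
      moreover have "\<omega> * N (f z) = \<omega> * N z + \<omega> * G z"
        by (simp add: Nf[OF zz(1) s1] algebra_simps)
      then have "Re (\<omega> * N (f z)) = Re (\<omega> * N z) + Re (\<omega> * G z)"
        by (simp only: plus_complex.sel)
      then have "Re (\<omega> * N (f z)) > \<rho>" using G(1) z by (simp add: P_def)
      ultimately show ?thesis by (simp add: P_def)
    qed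
    have PK: "z \<in> K" if z: "z \<in> P" for z
    proof (rule orbit_bounded_in_K)
      fix n
      have "(f ^^ n) z \<in> P" by (induction n) (auto simp: z step)
      from near[OF this] show "cmod ((f ^^ n) z) \<le> cmod z0 + \<delta>"
        using norm_triangle_ineq2[of "(f ^^ n) z" z0] by linarith
    qed
    define c where "c = Re (\<omega> * (1 / u ^ j))"
    have c: "c > 0" using \<omega>(2) by (simp add: c_def)
    \<comment> \<open>On the ray in direction \<open>u\<close> one has
      \<open>N (z0 + t * u) = 1 / (t * u) ^ j\<close>, so a small \<open>t\<close> brings the point
      into \<open>P\<close>.\<close>
    obtain t :: real where t: "t > 0" "t ^ j * \<rho> < c"
    proof -
      have "((\<lambda>t. t ^ j * \<rho>) \<longlongrightarrow> 0 ^ j * \<rho>) (at_right 0)" by (intro tendsto_intros)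
      then have "\<forall>\<^sub>F t in at_right 0. t ^ j * \<rho> < c"
        using c j by (intro order_tendstoD(2)[where y = "0 ^ j * \<rho>"]) (auto simp: power_0_left)
      moreover have "\<forall>\<^sub>F t in at_right (0::real). 0 < t" by (rule eventually_at_right_less)
      ultimately have "\<forall>\<^sub>F t in at_right (0::real). 0 < t \<and> t ^ j * \<rho> < c"
        by eventually_elim simp
      then have "\<exists>t. 0 < t \<and> t ^ j * \<rho> < c" by (rule eventually_happens'[rotated]) simp
      then show thesis using that by blast
    qed
    have "\<omega> * N (z0 + t * u) = (\<omega> * (1 / u ^ j)) / complex_of_real (t ^ j)"
      by (simp add: N_def power_mult_distrib)
    then have "Re (\<omega> * N (z0 + t * u)) = c / t ^ j"
      by (simp only: Re_divide_of_real c_def)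
    also have "\<dots> > \<rho>" using t by (simp add: field_simps)
    finally have "z0 + t * u \<in> P" using t u0 by (simp add: P_def)
    from e(2)[OF PK[OF this]] have "0 \<le> Re (e * (t * u))" by simp
    also have "e * (t * u) = (e * u) * complex_of_real t" by simp
    also have "Re \<dots> = Re (e * u) * t" by (simp add: algebra_simps)
    finally show False using u t(1) by (simp add: zero_le_mult_iff)
  qed
  \<comment> \<open>By \<open>incompatible\<close>, \<open>1 / u ^ j\<close> must be opposite to
    \<open>\<kappa>\<close> for every \<open>u\<close> beyond the line. Two such directions refute
    this: the turn by \<open>1 / (2 * j)\<close> keeps \<open>u2\<close> beyond the line, but the
    \<open>j\<close>-th powers differ by the angle \<open>1 / 2\<close>, which is not a multiple of
    pi.\<close>
  define u1 where "u1 = - cnj e"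
  define u2 where "u2 = - cnj e * cis (1 / (2 * j))"
  have ee: "e * cnj e = complex_of_real ((cmod e)\<^sup>2)" using complex_norm_square[of e] by simp
  have "e * u1 = - complex_of_real ((cmod e)\<^sup>2)" using ee by (simp add: u1_def)
  then have "Re (e * u1) = - (cmod e)\<^sup>2" by simp
  then have u1: "Re (e * u1) < 0" using e(1) by simp
  have "e * u2 = - complex_of_real ((cmod e)\<^sup>2) * cis (1 / (2 * j))"
    unfolding ee[symmetric] by (simp add: u2_def)
  then have "Re (e * u2) = - (cmod e)\<^sup>2 * cos (1 / (2 * j))" by simp
  moreover have "cos (1 / (2 * real j)) > 0"
  proof (rule cos_gt_zero)
    show "0 < 1 / (2 * real j)" using j by simp
    have "1 / (2 * real j) \<le> 1 / 2" using j by (simp add: field_simps)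
    also have "\<dots> < pi / 2" using pi_gt3 by simp
    finally show "1 / (2 * real j) < pi / 2" .
  qed
  ultimately have u2: "Re (e * u2) < 0" using e(1) by (simp add: mult_pos_pos)
  have bad: "(1 / u ^ j) * cnj \<kappa> \<in> \<real>\<^sub>\<le>\<^sub>0" if u: "Re (e * u) < 0" for u
    using common_half_plane[of "1 / u ^ j" \<kappa>] incompatible u by metis
  have "u2 ^ j = u1 ^ j * cis (1 / 2)"
  proof -
    have "u2 = u1 * cis (1 / (2 * j))" by (simp add: u1_def u2_def)
    then have "u2 ^ j = u1 ^ j * cis (1 / (2 * j)) ^ j" by (simp only: power_mult_distrib)
    then show ?thesis using j by (simp add: Complex.DeMoivre)
  qed
  then have eq: "(1 / u1 ^ j) * cnj \<kappa> = (1 / u2 ^ j) * cnj \<kappa> * cis (1 / 2)"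
    by (simp add: field_simps)
  obtain r1 r2 where r: "(1 / u1 ^ j) * cnj \<kappa> = complex_of_real r1"
      "(1 / u2 ^ j) * cnj \<kappa> = complex_of_real r2"
    using bad[OF u1] bad[OF u2] by (auto elim!: nonpos_Reals_cases)
  have "complex_of_real r1 = complex_of_real r2 * cis (1 / 2)" using eq unfolding r .
  then have "Im (complex_of_real r1) = Im (complex_of_real r2 * cis (1 / 2))" by simp
  then have "r2 * sin (1 / 2) = 0" by simp
  moreover have "sin (1 / 2 :: real) > 0" by (rule sin_gt_zero) (use pi_gt3 in auto)
  ultimately have "r2 = 0" by simp
  then have "u2 = 0" using r(2) \<kappa> j by simp
  then show False using u2 by simp
qed

lemma multiplier_gt_1: "cmod m > 1"
  using multiplier_ge_1 multiplier_neq_1 multiplier_pos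
  by (metis less_eq_real_def of_real_1)

end

subsection \<open>Linearization at a repelling fixed point\<close>

text \<open>Koenigs' limit of \<open>Fn n z = f^n (z0 + z / m ^ n)\<close>. Passing from one
  approximation to the next makes a quadratic error at the start, which shrinks by
  \<open>|m|^2\<close> at each rescaling while \<open>f\<close> expands it by little more than
  \<open>|m|\<close>. So the limit exists near 0, and the functional equation carries it to the
  whole plane.\<close>

lemma koenigs_linearization:
  fixes p :: "complex poly" and z0 m :: complex
  assumes fp: "poly p z0 = z0" and m: "m = poly (pderiv p) z0" and m1: "cmod m > 1"
  obtains F where "F holomorphic_on UNIV" "\<And>z. F (m * z) = poly p (F z)" "F 0 = z0"
    "(F has_field_derivative 1) (at 0)"
proof -
  define f where "f = poly p"
  have m0: "m \<noteq> 0" using m1 by auto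
  obtain r where r: "\<And>w. f (z0 + w) = z0 + m * w + w\<^sup>2 * poly r w"
  proof -
    obtain a b r where abr: "pcompose p [:z0, 1:] = pCons a (pCons b r)"
      by (metis pCons_cases)
    have eq: "f (z0 + w) = a + w * (b + w * poly r w)" for w
      using arg_cong[OF abr, of "\<lambda>q. poly q w"] by (simp add: poly_pcompose f_def)
    have "a = z0" using eq[of 0] fp by (simp add: f_def)
    have "((\<lambda>w. f (z0 + w)) has_field_derivative m * 1) (at 0)"
      by (rule DERIV_chain2[of f]) (auto simp: f_def m intro!: derivative_eq_intros poly_DERIV)
    then have "((\<lambda>w. f (z0 + w)) has_field_derivative m) (at 0)" by simp
    moreover have "((\<lambda>w. a + w * (b + w * poly r w)) has_field_derivative b) (at 0)"
      by (auto intro!: derivative_eq_intros poly_DERIV)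
    ultimately have "b = m" unfolding eq using DERIV_unique by blast
    show thesis
      by (rule that[of r]) (simp only: eq \<open>a = z0\<close> \<open>b = m\<close>, simp add: algebra_simps power2_eq_square)
  qed
  have "bounded (poly r ` cball 0 1)"
    by (intro compact_imp_bounded compact_continuous_image continuous_intros compact_cball)
  then obtain A where A: "A > 0" "\<And>w. cmod w \<le> 1 \<Longrightarrow> cmod (poly r w) \<le> A"
    unfolding bounded_pos by auto
  have "cmod m < (cmod m)\<^sup>2" 
    unfolding power2_eq_square using m1 by (metis less_trans mult_1 mult_strict_right_mono zero_less_one)
  \<comment> \<open>Being above \<open>|m|\<close>, \<open>\<Lambda>\<close> is a Lipschitz constant
    of \<open>f\<close> near \<open>z0\<close>; being below \<open>|m|^2\<close>, it makes the ratio
    \<open>\<theta>\<close> of successive errors less than 1.\<close>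
  then obtain \<Lambda> where \<Lambda>: "cmod m < \<Lambda>" "\<Lambda> < (cmod m)\<^sup>2" using dense by blast
  define \<theta> where "\<theta> = \<Lambda> / (cmod m)\<^sup>2"
  have \<theta>: "0 < \<theta>" "\<theta> < 1" using \<Lambda> m1 by (auto simp: \<theta>_def divide_simps)
  obtain r0 where r0: "r0 > 0"
    and Lip: "\<And>x y. x \<in> cball z0 r0 \<Longrightarrow> y \<in> cball z0 r0 \<Longrightarrow> cmod (f x - f y) \<le> \<Lambda> * cmod (x - y)"
  proof -
    have "isCont (\<lambda>z. cmod (poly (pderiv p) z)) z0" by (intro continuous_intros)
    then have "\<forall>\<^sub>F z in nhds z0. cmod (poly (pderiv p) z) < \<Lambda>"
      unfolding eventually_nhds_conv_at isCont_def
      using \<Lambda>(1) by (auto simp: m intro: order_tendstoD(2))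
    then obtain d where d: "d > 0" "\<And>z. dist z z0 < d \<Longrightarrow> cmod (poly (pderiv p) z) < \<Lambda>"
      unfolding eventually_nhds_metric by blast
    show thesis
    proof (rule that[of "d / 2"])
      fix x y assume "x \<in> cball z0 (d / 2)" "y \<in> cball z0 (d / 2)"
      then show "cmod (f x - f y) \<le> \<Lambda> * cmod (x - y)"
        unfolding f_def
        by (intro field_differentiable_bound[of "cball z0 (d / 2)" "poly p" "poly (pderiv p)"])
           (use d in \<open>auto simp: dist_commute intro!: less_imp_le[OF d(2)] has_field_derivative_at_within[OF poly_DERIV]\<close>)
    qed (use d in simp)
  qed
  define Fn where "Fn n z = (f ^^ n) (z0 + z / m ^ n)" for n z
  have Fn0: "Fn 0 z = z0 + z" for z by (simp add: Fn_def)
  have FnS: "Fn (Suc n) z = f (Fn n (z / m))" for n z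
    by (simp add: Fn_def mult.commute)
  define C where "C = A / (1 - \<theta>)"
  have C: "C > 0" using A \<theta> by (simp add: C_def)
  \<comment> \<open>For \<open>|z| \<le> \<rho>\<close> the total error is at most
    \<open>C * |z|^2 \<le> C * |z|\<close>, so no approximation leaves the ball on which
    \<open>Lip\<close> holds.\<close>
  define \<rho> where "\<rho> = min 1 (r0 / (1 + C))"
  have "\<rho> * (1 + C) \<le> r0 / (1 + C) * (1 + C)"
    using C by (intro mult_right_mono) (auto simp: \<rho>_def)
  then have \<rho>: "\<rho> > 0" "\<rho> \<le> 1" "\<rho> * (1 + C) \<le> r0"
    using r0 C by (auto simp: \<rho>_def)
  have geo: "A * x\<^sup>2 * (\<Sum>i<n. \<theta> ^ i) \<le> C * x\<^sup>2" for n x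
  proof -
    have "(\<Sum>i<n. \<theta> ^ i) = (1 - \<theta> ^ n) / (1 - \<theta>)" using \<theta> by (simp add: sum_gp_strict)
    also have "\<dots> \<le> 1 / (1 - \<theta>)" using \<theta> by (intro divide_right_mono) auto
    finally have "A * x\<^sup>2 * (\<Sum>i<n. \<theta> ^ i) \<le> A * x\<^sup>2 * (1 / (1 - \<theta>))"
      using A by (intro mult_left_mono) auto
    then show ?thesis by (simp add: C_def)
  qed
  have inball: "Fn n z \<in> cball z0 r0"
    if "cmod (Fn n z - z0 - z) \<le> A * (cmod z)\<^sup>2 * (\<Sum>i<n. \<theta> ^ i)" "cmod z \<le> \<rho>" for n z
  proof -
    have "cmod (Fn n z - z0) \<le> cmod (Fn n z - z0 - z) + cmod z"
      by (metis diff_add_cancel norm_triangle_ineq)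
    also have "\<dots> \<le> C * (cmod z)\<^sup>2 + cmod z" using that(1) geo[of "cmod z" n] by linarith
    also have "(cmod z)\<^sup>2 \<le> cmod z"
      using that(2) \<rho> by (simp add: power2_eq_square mult_left_le_one_le)
    then have "C * (cmod z)\<^sup>2 + cmod z \<le> C * cmod z + cmod z" using C by simp
    also have "C * cmod z + cmod z = cmod z * (1 + C)" by (simp add: algebra_simps)
    also have "\<dots> \<le> \<rho> * (1 + C)" using that(2) C by (intro mult_right_mono) auto
    finally show ?thesis using \<rho> by (simp add: dist_norm norm_minus_commute)
  qed
  \<comment> \<open>The two claims need a joint induction: the estimate of the next difference uses
    the Lipschitz bound, which applies only because the second claim keeps the approximations in the
    ball.\<close>
  have main: "(\<forall>z. cmod z \<le> \<rho> \<longrightarrow> cmod (Fn (Suc n) z - Fn n z) \<le> A * \<theta> ^ n * (cmod z)\<^sup>2) \<and>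
      (\<forall>z. cmod z \<le> \<rho> \<longrightarrow> cmod (Fn n z - z0 - z) \<le> A * (cmod z)\<^sup>2 * (\<Sum>i<n. \<theta> ^ i))" for n
  proof (induction n)
    case 0
    have "cmod (Fn (Suc 0) z - Fn 0 z) \<le> A * (cmod z)\<^sup>2" if z: "cmod z \<le> \<rho>" for z
    proof -
      have "Fn (Suc 0) z - Fn 0 z = (z / m)\<^sup>2 * poly r (z / m)"
        using m0 by (simp add: FnS Fn0 r)
      then have "cmod (Fn (Suc 0) z - Fn 0 z) = (cmod (z / m))\<^sup>2 * cmod (poly r (z / m))"
        by (simp add: norm_mult norm_power)
      also have "cmod (z / m) \<le> cmod z"
        using m1 by (simp add: norm_divide divide_le_eq mult_left_le_one_le mult_le_cancel_left1)
      then have "(cmod (z / m))\<^sup>2 * cmod (poly r (z / m)) \<le> (cmod z)\<^sup>2 * A"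
        using z \<rho> by (intro mult_mono power_mono A) auto
      finally show ?thesis by (simp add: mult.commute)
    qed
    then show ?case by (simp add: Fn0)
  next
    case (Suc n)
    have 2: "cmod (Fn (Suc n) z - z0 - z) \<le> A * (cmod z)\<^sup>2 * (\<Sum>i<Suc n. \<theta> ^ i)"
      if z: "cmod z \<le> \<rho>" for z
    proof -
      have "cmod (Fn (Suc n) z - z0 - z) \<le> cmod (Fn (Suc n) z - Fn n z) + cmod (Fn n z - z0 - z)"
        by (rule order_trans[OF _ norm_triangle_ineq]) (simp add: algebra_simps)
      also have "\<dots> \<le> A * \<theta> ^ n * (cmod z)\<^sup>2 + A * (cmod z)\<^sup>2 * (\<Sum>i<n. \<theta> ^ i)"
        using Suc z by (intro add_mono) auto
      finally show ?thesis by (simp add: algebra_simps)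
    qed
    have 1: "cmod (Fn (Suc (Suc n)) z - Fn (Suc n) z) \<le> A * \<theta> ^ Suc n * (cmod z)\<^sup>2"
      if z: "cmod z \<le> \<rho>" for z
    proof -
      have "cmod (z / m) \<le> cmod z"
        using m1 by (simp add: norm_divide divide_le_eq mult_left_le_one_le mult_le_cancel_left1)
      then have zm: "cmod (z / m) \<le> \<rho>" using z by linarith
      have "cmod (Fn (Suc (Suc n)) z - Fn (Suc n) z) = cmod (f (Fn (Suc n) (z / m)) - f (Fn n (z / m)))"
        by (simp only: FnS)
      also have "\<dots> \<le> \<Lambda> * cmod (Fn (Suc n) (z / m) - Fn n (z / m))"
        using Suc zm 2 by (intro Lip inball) auto
      also have "\<dots> \<le> \<Lambda> * (A * \<theta> ^ n * (cmod (z / m))\<^sup>2)"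
        using Suc zm \<Lambda> m1 by (intro mult_left_mono) auto
      also have "\<dots> = A * \<theta> ^ Suc n * (cmod z)\<^sup>2"
        by (simp add: \<theta>_def norm_divide power_divide mult_ac)
      finally show ?thesis .
    qed
    show ?case using 1 2 by blast
  qed
  define D where "D i z = Fn (Suc i) z - Fn i z" for i z
  have ul: "uniform_limit (cball 0 \<rho>) (\<lambda>n z. \<Sum>i<n. D i z) (\<lambda>z. \<Sum>i. D i z) sequentially"
  proof (rule Weierstrass_m_test)
    show "summable (\<lambda>n. A * \<theta> ^ n)" using \<theta> by (intro summable_mult summable_geometric) auto
    fix n and z :: complex assume "z \<in> cball 0 \<rho>"
    then have z: "cmod z \<le> \<rho>" by simp
    have "cmod (D n z) \<le> A * \<theta> ^ n * (cmod z)\<^sup>2" using main[of n] z by (simp add: D_def)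
    also have "\<dots> \<le> A * \<theta> ^ n * 1"
      using A \<theta> z \<rho> by (intro mult_left_mono power_le_one) auto
    finally show "cmod (D n z) \<le> A * \<theta> ^ n" by simp
  qed
  define Fl where "Fl z = z0 + z + (\<Sum>i. D i z)" for z
  have sumD: "z0 + z + (\<Sum>i<n. D i z) = Fn n z" for n z
    unfolding D_def by (subst sum_lessThan_telescope) (simp add: Fn0)
  have "uniform_limit (cball 0 \<rho>) (\<lambda>n z. z0 + z + (\<Sum>i<n. D i z)) (\<lambda>z. z0 + z + (\<Sum>i. D i z)) sequentially"
    by (intro uniform_limit_add ul uniform_limit_const)
  then have ul': "uniform_limit (cball 0 \<rho>) Fn Fl sequentially"
    unfolding sumD Fl_def[symmetric] .
  have holfn: "(f ^^ n) holomorphic_on UNIV" for n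
  proof (induction n)
    case (Suc n)
    have "f holomorphic_on UNIV" unfolding f_def holomorphic_on_def
      using poly_DERIV field_differentiable_at_within field_differentiable_def by blast
    then show ?case using holomorphic_on_compose[OF Suc, of f] holomorphic_on_subset
      by (simp add: o_def)
  qed (simp add: id_def holomorphic_on_ident)
  have holFn: "Fn n holomorphic_on S" for n S
  proof -
    have "(f ^^ n) \<circ> (\<lambda>z. z0 + z / m ^ n) holomorphic_on S"
      using m0 by (intro holomorphic_on_compose_gen[OF _ holfn[of n]] holomorphic_intros) auto
    then show ?thesis by (simp add: o_def Fn_def[abs_def])
  qed
  have holFl: "Fl holomorphic_on ball 0 \<rho>"
  proof (rule holomorphic_uniform_sequence[OF open_ball holFn])
    fix x :: complex assume "x \<in> ball 0 \<rho>"
    then obtain d where d: "d > 0" "cball x d \<subseteq> ball 0 \<rho>"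
      using open_contains_cball open_ball by meson
    then have "cball x d \<subseteq> cball 0 \<rho>" using ball_subset_cball by blast
    then show "\<exists>d>0. cball x d \<subseteq> ball 0 \<rho> \<and> uniform_limit (cball x d) Fn Fl sequentially"
      using d uniform_limit_on_subset[OF ul'] by blast
  qed
  have ptw: "(\<lambda>n. Fn n z) \<longlonglongrightarrow> Fl z" if "cmod z < \<rho>" for z
    using tendsto_uniform_limitI[OF ul', of z] that by simp
  define F where "F z = lim (\<lambda>n. Fn n z)" for z
  have ext: "Fn (n + k) z = (f ^^ k) (Fn n (z / m ^ k))" for n k z
    unfolding Fn_def add.commute[of n k] by (simp add: funpow_add power_add)
  \<comment> \<open>Applying \<open>f ^^ k\<close> to the local limit at \<open>z / m ^ k\<close>
    gives convergence on a disc of radius \<open>|m| ^ k * \<rho>\<close>, and these discs exhaust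
    the plane.\<close>
  have lim: "(\<lambda>n. Fn n z) \<longlonglongrightarrow> (f ^^ k) (Fl (z / m ^ k))" if "cmod (z / m ^ k) < \<rho>" for k z
  proof -
    have "isCont (f ^^ k) (Fl (z / m ^ k))"
      using holfn[of k] holomorphic_on_imp_continuous_on continuous_on_eq_continuous_at open_UNIV by blast
    from isCont_tendsto_compose[OF this ptw[OF that]]
    have "(\<lambda>n. Fn (n + k) z) \<longlonglongrightarrow> (f ^^ k) (Fl (z / m ^ k))" by (simp add: ext)
    then show ?thesis by (simp add: LIMSEQ_offset)
  qed
  have ex: "\<exists>k. R < cmod m ^ k * \<rho>" for R
  proof -
    obtain k where "R / \<rho> < cmod m ^ k" using real_arch_pow[OF m1] by blast
    then show ?thesis using \<rho> by (auto simp: field_simps)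
  qed
  have small: "cmod (z / m ^ k) < \<rho>" if "cmod z < cmod m ^ k * \<rho>" for z k
    using that m1 m0 by (simp add: norm_divide norm_power divide_simps mult.commute)
  have limF: "(\<lambda>n. Fn n z) \<longlonglongrightarrow> F z" for z
    using ex[of "cmod z"] lim small unfolding F_def by (metis limI)
  show thesis
  proof (rule that[of F])
    show "F holomorphic_on UNIV"
      unfolding holomorphic_on_def
    proof
      fix z :: complex
      obtain k where k: "cmod z < cmod m ^ k * \<rho>" using ex by blast
      let ?B = "ball (0::complex) (cmod m ^ k * \<rho>)"
      have "Fl \<circ> (\<lambda>z. z / m ^ k) holomorphic_on ?B"
        using m0 small by (intro holomorphic_on_compose_gen[OF _ holFl] holomorphic_intros) auto
      then have "(f ^^ k) \<circ> (Fl \<circ> (\<lambda>z. z / m ^ k)) holomorphic_on ?B"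
        by (rule holomorphic_on_compose_gen[OF _ holfn[of k]]) auto
      moreover have "((f ^^ k) \<circ> (Fl \<circ> (\<lambda>z. z / m ^ k))) z = F z" if "z \<in> ?B" for z
        using LIMSEQ_unique[OF lim limF] small that by auto
      ultimately have "F holomorphic_on ?B" using holomorphic_transform by blast
      then show "F field_differentiable at z within UNIV"
        using k by (auto simp: holomorphic_on_open field_differentiable_def)
    qed
    show "F (m * z) = poly p (F z)" for z
    proof -
      have "isCont f (F z)" by (simp add: f_def)
      from isCont_tendsto_compose[OF this limF]
      have "(\<lambda>n. Fn (Suc n) (m * z)) \<longlonglongrightarrow> f (F z)" using m0 by (simp add: FnS)
      then show ?thesis using LIMSEQ_unique limF[THEN LIMSEQ_Suc] f_def by blast
    qed
    have fz0: "(f ^^ n) z0 = z0" for n by (induction n) (auto simp: f_def fp)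
    have "(\<lambda>n. Fn n 0) \<longlonglongrightarrow> z0" by (simp add: Fn_def fz0)
    then show F0: "F 0 = z0" using LIMSEQ_unique limF by blast
    have bd: "cmod (F z - z0 - z) \<le> C * (cmod z)\<^sup>2" if z: "cmod z \<le> \<rho>" for z
    proof (rule tendsto_upperbound)
      show "(\<lambda>n. cmod (Fn n z - z0 - z)) \<longlonglongrightarrow> cmod (F z - z0 - z)"
        by (intro tendsto_intros limF)
      show "\<forall>\<^sub>F n in sequentially. cmod (Fn n z - z0 - z) \<le> C * (cmod z)\<^sup>2"
        using main z geo order_trans by (intro always_eventually) blast
    qed simp
    show "(F has_field_derivative 1) (at 0)"
      unfolding has_field_derivative_iff
    proof (rule Lim_transform_eventually[where f = "\<lambda>h. (F h - z0 - h) / h + 1"])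
      have "((\<lambda>h. (F h - z0 - h) / h) \<longlongrightarrow> 0) (at 0)"
      proof (rule Lim_null_comparison)
        have "\<forall>\<^sub>F h in at (0::complex). h \<noteq> 0 \<and> dist h 0 < \<rho>"
          using \<rho> by (auto simp: eventually_at intro!: exI[of _ \<rho>])
        then show "\<forall>\<^sub>F h in at 0. cmod ((F h - z0 - h) / h) \<le> C * cmod h"
          by eventually_elim
             (use bd in \<open>simp add: norm_divide divide_le_eq power2_eq_square mult.assoc\<close>)
        show "((\<lambda>h. C * cmod h) \<longlongrightarrow> 0) (at 0)" by (auto intro!: tendsto_eq_intros)
      qed
      then have "((\<lambda>h. (F h - z0 - h) / h + 1) \<longlongrightarrow> 0 + 1) (at 0)"
        by (intro tendsto_add tendsto_const)
      then show "((\<lambda>h. (F h - z0 - h) / h + 1) \<longlongrightarrow> 1) (at 0)"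
        by (simp only: add_0_left)
      show "\<forall>\<^sub>F h in at 0. (F h - z0 - h) / h + 1 = (F h - F 0) / (h - 0)"
        by (auto simp: eventually_at F0 field_simps intro!: exI[of _ 1])
    qed
  qed
qed

subsection \<open>The linearization pulls the filled Julia set back to a half plane\<close>

context frontier_fixed_point
begin

text \<open>The open tangent cone of \<open>U\<close> at \<open>z0\<close>. As \<open>z0\<close>
  lies in the convex set \<open>K\<close>, a ray that meets \<open>U\<close> at some parameter is in
  \<open>U\<close> at all smaller positive ones; so the cone is what \<open>U\<close> looks like
  when magnified at \<open>z0\<close>.\<close>

definition T where "T = {v. \<exists>t>0. z0 + complex_of_real t * v \<in> U}"

lemma T_scale: "v \<in> T \<Longrightarrow> t > 0 \<Longrightarrow> complex_of_real t * v \<in> T"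
proof -
  assume v: "v \<in> T" and t: "t > 0"
  then obtain r :: real where "r > 0" "z0 + r * v \<in> U" by (auto simp: T_def)
  then have "r / t > 0 \<and> z0 + complex_of_real (r / t) * (complex_of_real t * v) \<in> U"
    using t by simp
  then show ?thesis unfolding T_def by blast
qed

lemma in_U_shrink:
  assumes "z0 + complex_of_real t * v \<in> U" "0 < s" "s \<le> t"
  shows "z0 + complex_of_real s * v \<in> U"
proof -
  have "z0 + complex_of_real (s / t) * (z0 + t * v - z0) \<in> U"
    using assms by (intro segment_in_U z0) (auto simp: divide_le_eq)
  then show ?thesis using assms by simp
qed

lemma open_T: "open T"
proof -
  have "T = (\<Union>t\<in>{0<..}. (\<lambda>v. z0 + complex_of_real t * v) -` U)" by (auto simp: T_def)
  then show ?thesis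
    by (auto intro!: open_UN open_vimage continuous_intros)
qed

lemma convex_T: "convex T"
proof (rule convexI)
  fix x y and a b :: real assume xy: "x \<in> T" "y \<in> T" and ab: "0 \<le> a" "0 \<le> b" "a + b = 1"
  obtain s t :: real where st: "s > 0" "t > 0" "z0 + s * x \<in> U" "z0 + t * y \<in> U"
    using xy by (auto simp: T_def)
  define r where "r = min s t"
  have r: "r > 0" "z0 + r * x \<in> U" "z0 + r * y \<in> U"
    using st in_U_shrink[of s x r] in_U_shrink[of t y r] by (auto simp: r_def)
  have "a *\<^sub>R (z0 + r * x) + b *\<^sub>R (z0 + r * y) \<in> U"
    using convexD[OF convex_U r(2,3) ab] .
  also have "a *\<^sub>R (z0 + r * x) + b *\<^sub>R (z0 + r * y) = (a + b) *\<^sub>R z0 + r * (a *\<^sub>R x + b *\<^sub>R y)"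
    by (simp add: scaleR_conv_of_real algebra_simps)
  finally show "a *\<^sub>R x + b *\<^sub>R y \<in> T" using r(1) ab by (auto simp: T_def)
qed

lemma T_nonempty: "T \<noteq> {}"
proof -
  obtain z where "z \<in> U" using interior_K by blast
  then have "z - z0 \<in> T" by (auto simp: T_def intro!: exI[of _ 1])
  then show ?thesis by blast
qed

text \<open>The midpoint of an interior point and a point of the closure is interior, and doubling
  it stays in the cone. The case \<open>v = w\<close> is separate because the open segment is then
  empty.\<close>

lemma T_add_closure:
  assumes "v \<in> T" "w \<in> closure T"
  shows "v + w \<in> T"
proof (cases "v = w")
  case True
  then show ?thesis using T_scale[OF assms(1), of 2] by simp
next
  case False
  have "v \<in> interior T" using assms open_T by (simp add: interior_open)
  from in_interior_closure_convex_segment[OF convex_T this assms(2)]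
  have "open_segment v w \<subseteq> T" using open_T by (simp add: interior_open)
  moreover have "midpoint v w \<in> open_segment v w" using False by simp
  ultimately have "midpoint v w \<in> T" by blast
  from T_scale[OF this, of 2] have "complex_of_real 2 * midpoint v w \<in> T" by simp
  also have "complex_of_real 2 * midpoint v w = v + w"
    by (simp add: midpoint_def scaleR_conv_of_real)
  finally show ?thesis .
qed

lemma T_span:
  assumes v: "v \<in> T" "\<beta> > 0" and x: "x \<in> closure T" "\<alpha> < 0 \<Longrightarrow> - x \<in> closure T"
  shows "complex_of_real \<alpha> * x + complex_of_real \<beta> * v \<in> T"
proof (cases \<alpha> "0 :: real" rule: linorder_cases)
  case equal
  then show ?thesis using T_scale v by simp
next
  case greater
  have "complex_of_real \<alpha> * (complex_of_real (\<beta> / \<alpha>) * v + x) \<in> T"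
    using greater v x by (intro T_scale T_add_closure) auto
  also have "complex_of_real \<alpha> * (complex_of_real (\<beta> / \<alpha>) * v + x) = \<alpha> * x + \<beta> * v"
    using greater by (simp add: distrib_left)
  finally show ?thesis .
next
  case less
  have "complex_of_real (- \<alpha>) * (complex_of_real (\<beta> / (- \<alpha>)) * v + - x) \<in> T"
    using less v x by (intro T_scale T_add_closure) (auto simp: field_simps)
  also have "complex_of_real (- \<alpha>) * (complex_of_real (\<beta> / (- \<alpha>)) * v + - x) = \<alpha> * x + \<beta> * v"
    using less by (simp add: right_diff_distrib)
  finally show ?thesis .
qed

text \<open>These are the two values for Picard's theorem: if \<open>F\<close> took the value
  \<open>z0\<close> only at 0, then it would omit \<open>u\<close>, and therefore also
  \<open>u'\<close>. A preimage \<open>u\<close> other than \<open>z0\<close> exists because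
  \<open>m \<noteq> 0\<close> makes \<open>z0\<close> a simple root of \<open>p - z0\<close>, whose
  degree is at least 2.\<close>

lemma repeated_preimage:
  obtains u u' where "u \<noteq> z0" "f u = z0" "u' \<noteq> u" "f u' = u"
proof -
  have "poly (p - [:z0:]) z0 = 0" by (simp add: z0)
  then obtain r where r: "p - [:z0:] = [:- z0, 1:] * r" unfolding poly_eq_0_iff_dvd by (rule dvdE)
  have fr: "f z = z0 + (z - z0) * poly r z" for z
    using arg_cong[OF r, of "\<lambda>q. poly q z"] by (simp add: algebra_simps)
  have "poly (pderiv ([:- z0, 1:] * r)) z0 = poly r z0"
    unfolding pderiv_mult by (simp add: pderiv_pCons)
  moreover have "pderiv ([:- z0, 1:] * r) = pderiv p"
    unfolding r[symmetric] by (simp add: pderiv_diff pderiv_pCons)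
  ultimately have "m = poly r z0" by (simp add: m_def)
  then have rz0: "poly r z0 \<noteq> 0" using multiplier_gt_1 by auto
  then have "r \<noteq> 0" by auto
  have "degree (p - [:z0:]) = degree p"
    using degree_add_eq_left[of "- [:z0:]" p] degree_ge_2 by (simp del: minus_pCons)
  moreover have "degree ([:- z0, 1:] * r) = Suc (degree r)"
    using \<open>r \<noteq> 0\<close> by (subst degree_mult_eq) auto
  ultimately have "degree p = Suc (degree r)" by (simp only: r)
  then have "\<not> constant (poly r)" using degree_ge_2 by (simp add: constant_degree)
  then obtain u where u: "poly r u = 0" using fundamental_theorem_of_algebra by blast
  have "degree (p - [:u:]) = degree p"
    using degree_add_eq_left[of "- [:u:]" p] degree_ge_2 by (simp del: minus_pCons)
  then have "\<not> constant (poly (p - [:u:]))" using degree_ge_2 by (simp add: constant_degree)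
  then obtain u' where u': "poly (p - [:u:]) u' = 0" using fundamental_theorem_of_algebra by blast
  have "u \<noteq> z0" using u rz0 by auto
  moreover have "f u = z0" using fr u by simp
  moreover have "f u' = u" using u' by simp
  ultimately show thesis using that by metis
qed

lemma linearization_half_plane:
  obtains F where "F holomorphic_on UNIV" "\<And>z. F (m * z) = f (F z)"
    "\<And>z. F z \<in> U \<longleftrightarrow> Im z < 0" "\<And>z. F z \<in> K \<longleftrightarrow> Im z \<le> 0"
proof -
  define \<mu> where "\<mu> = cmod m"
  have \<mu>: "\<mu> > 1" "m = complex_of_real \<mu>"
    using multiplier_gt_1 multiplier_pos by (auto simp: \<mu>_def)
  obtain F where F: "F holomorphic_on UNIV" "\<And>z. F (m * z) = f (F z)" "F 0 = z0"
      "(F has_field_derivative 1) (at 0)"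
    using koenigs_linearization[OF z0(3) m_def multiplier_gt_1] by blast
  have Fn: "F z = (f ^^ n) (F (z / m ^ n))" for n z
  proof (induction n arbitrary: z)
    case (Suc n)
    have "F z = F (m * (z / m))" using \<mu> by simp
    also have "\<dots> = f (F (z / m))" by (rule F(2))
    also have "F (z / m) = (f ^^ n) (F (z / m / m ^ n))" by (rule Suc)
    finally show ?case by (simp add: mult.commute)
  qed simp
  \<comment> \<open>The rescaled map tends to the identity since \<open>F\<close> has derivative 1
    at 0. By invariance, whether \<open>F v\<close> is in \<open>U\<close> or \<open>K\<close> is
    decided at \<open>F (v / m ^ n)\<close>, arbitrarily close to \<open>z0\<close>, where these
    sets look like the cone.\<close>
  define w where "w v n = complex_of_real (\<mu> ^ n) * (F (v / m ^ n) - z0)" for v and n :: nat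
  have F_w: "F (v / m ^ n) = z0 + complex_of_real (1 / \<mu> ^ n) * w v n" for v n
    using \<mu> by (simp add: w_def)
  have w_lim: "w v \<longlonglongrightarrow> v" for v
  proof (cases "v = 0")
    case True
    then show ?thesis by (simp add: w_def[abs_def] F)
  next
    case False
    have "cmod (inverse m) < 1"
      using multiplier_gt_1 by (metis inverse_less_1_iff norm_inverse)
    then have "(\<lambda>n. inverse m ^ n) \<longlonglongrightarrow> 0" by (rule LIMSEQ_power_zero)
    then have "(\<lambda>n. v * inverse m ^ n) \<longlonglongrightarrow> v * 0" by (intro tendsto_mult tendsto_const)
    then have "filterlim (\<lambda>n. v / m ^ n) (at 0) sequentially"
      unfolding filterlim_at using False \<mu> by (simp add: divide_inverse flip: power_inverse)
    moreover have "((\<lambda>h. (F h - z0) / h) \<longlongrightarrow> 1) (at 0)"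
      using F(4) by (simp add: has_field_derivative_iff F(3))
    ultimately have "(\<lambda>n. (F (v / m ^ n) - z0) / (v / m ^ n)) \<longlonglongrightarrow> 1"
      by (rule filterlim_compose[rotated])
    then have "(\<lambda>n. v * ((F (v / m ^ n) - z0) / (v / m ^ n))) \<longlonglongrightarrow> v * 1"
      by (intro tendsto_intros)
    moreover have "v * ((F (v / m ^ n) - z0) / (v / m ^ n)) = w v n" for n
      using False \<mu> by (simp add: w_def)
    ultimately show ?thesis by simp
  qed
  have FU1: "F v \<in> U" if v: "v \<in> T" for v
  proof -
    from v obtain t :: real where t: "t > 0" "z0 + t * v \<in> U" by (auto simp: T_def)
    have "(\<lambda>n. z0 + t * w v n) \<longlonglongrightarrow> z0 + t * v" by (intro tendsto_intros w_lim)
    then have "\<forall>\<^sub>F n in sequentially. z0 + t * w v n \<in> U"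
      using t(2) open_U by (metis topological_tendstoD)
    moreover have "(\<lambda>n. (1 / \<mu>) ^ n) \<longlonglongrightarrow> 0" by (rule LIMSEQ_power_zero) (use \<mu> in simp)
    then have "\<forall>\<^sub>F n in sequentially. (1 / \<mu>) ^ n < t" using t(1) by (rule order_tendstoD)
    ultimately have "\<forall>\<^sub>F n in sequentially. z0 + t * w v n \<in> U \<and> (1 / \<mu>) ^ n < t"
      by (rule eventually_conj)
    then obtain n where n: "z0 + t * w v n \<in> U" "(1 / \<mu>) ^ n < t"
      using eventually_happens'[of sequentially] by auto
    have "z0 + complex_of_real (1 / \<mu> ^ n) * w v n \<in> U"
      using in_U_shrink[OF n(1), of "1 / \<mu> ^ n"] n(2) \<mu> by (simp add: power_divide)
    then have "F (v / m ^ n) \<in> U" by (simp only: F_w)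
    then show ?thesis by (subst Fn[of _ n]) simp
  qed
  have FK1: "v \<in> closure T" if v: "F v \<in> K" for v
  proof (rule Lim_in_closed_set[OF closed_closure _ _ w_lim])
    show "\<forall>\<^sub>F n in sequentially. w v n \<in> closure T"
    proof (rule always_eventually, rule allI)
      fix n
      have "F (v / m ^ n) \<in> K" using v by (subst (asm) Fn[of _ n]) simp
      then have "F (v / m ^ n) \<in> closure U" by (simp add: closure_U)
      then have "complex_of_real (\<mu> ^ n) * (F (v / m ^ n) - z0) \<in>
          (\<lambda>z. complex_of_real (\<mu> ^ n) * (z - z0)) ` closure U" by blast
      also have "\<dots> \<subseteq> closure ((\<lambda>z. complex_of_real (\<mu> ^ n) * (z - z0)) ` U)"
        by (intro image_closure_subset continuous_intros closure_subset) auto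
      also have "\<dots> \<subseteq> closure T"
      proof (intro closure_mono image_subsetI)
        fix z assume "z \<in> U"
        then have "z - z0 \<in> T" by (auto simp: T_def intro!: exI[of _ 1])
        then show "complex_of_real (\<mu> ^ n) * (z - z0) \<in> T" using \<mu> by (intro T_scale) auto
      qed
      finally show "w v n \<in> closure T" by (simp add: w_def)
    qed
  qed simp
  have contF: "continuous_on S F" for S
    using F(1) holomorphic_on_imp_continuous_on continuous_on_subset by blast
  have FU: "F v \<in> U \<longleftrightarrow> v \<in> T" for v
  proof
    assume v: "F v \<in> U"
    have "open (F -` U)" by (intro open_vimage open_U contF)
    moreover have "F -` U \<subseteq> closure T" using FK1 U_subset_K by blast
    ultimately have "F -` U \<subseteq> interior (closure T)" by (rule interior_maximal[rotated])
    also have "\<dots> = T" using convex_interior_closure[OF convex_T] open_T by (simp add: interior_open)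
    finally show "v \<in> T" using v by blast
  qed (rule FU1)
  have FK: "F v \<in> K \<longleftrightarrow> v \<in> closure T" for v
  proof
    assume v: "v \<in> closure T"
    have "closed (F -` K)" by (intro closed_vimage closed_K contF)
    moreover have "T \<subseteq> F -` K" using FU1 U_subset_K by blast
    ultimately show "F v \<in> K" using closure_minimal v by blast
  qed (rule FK1)
  have nconst: "\<not> F constant_on UNIV"
  proof
    assume "F constant_on UNIV"
    then obtain c where "F = (\<lambda>z. c)" by (auto simp: constant_on_def)
    then have "(F has_field_derivative 0) (at 0)" by simp
    then show False using F(4) DERIV_unique by fastforce
  qed
  obtain s where s: "s \<noteq> 0" "F s = z0"
  proof (rule ccontr)
    assume "\<not> thesis"
    then have only0: "F s = z0 \<Longrightarrow> s = 0" for s using that by blast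
    obtain u u' where u: "u \<noteq> z0" "f u = z0" "u' \<noteq> u" "f u' = u" by (rule repeated_preimage)
    have nu: "F s \<noteq> u" for s
    proof
      assume "F s = u"
      then have "F (m * s) = z0" by (simp add: F u)
      then have "m * s = 0" by (rule only0)
      then have "s = 0" using \<mu> by simp
      then show False using \<open>F s = u\<close> F u by simp
    qed
    have nu': "F s \<noteq> u'" for s
    proof
      assume "F s = u'"
      then have "F (m * s) = u" by (simp add: F u)
      then show False using nu by blast
    qed
    have "range F \<inter> {u, u'} = {}" using nu nu' by auto
    then obtain c where "F = (\<lambda>x. c)"
      using little_Picard[OF F(1), of u u'] u by metis
    then show False using nconst by (auto simp: constant_on_def)
  qed
  have sT: "s \<in> closure T" "s \<notin> T" using FU[of s] FK[of s] s z0 by auto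
  obtain v where v: "v \<in> T" using T_nonempty by blast
  have nc: "\<not> (\<lambda>z. F z - z0) constant_on UNIV"
    using nconst unfolding constant_on_def by (metis diff_add_cancel UNIV_I)
  have holG: "(\<lambda>z. F z - z0) holomorphic_on UNIV" by (intro holomorphic_intros F(1))
  have Gs: "F s - z0 = 0" using s by simp
  obtain g r k where g: "0 < k" "0 < r" "g holomorphic_on ball s r"
      "\<And>z. z \<in> ball s r \<Longrightarrow> F z - z0 = (z - s) ^ k * g z" "\<And>z. z \<in> ball s r \<Longrightarrow> g z \<noteq> 0"
    by (rule holomorphic_factor_zero_nonconstant[OF holG open_UNIV connected_UNIV UNIV_I Gs nc]) blast
  \<comment> \<open>For \<open>\<beta> > 0\<close> the point \<open>s + \<epsilon> * h\<close> is in
    \<open>T\<close> for small \<open>\<epsilon> > 0\<close>, because its coefficient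
    \<open>1 + \<epsilon> * \<alpha>\<close> of \<open>s\<close> is positive. Its image minus
    \<open>z0\<close> is then in the cone; dividing by \<open>\<epsilon> ^ k\<close> and letting
    \<open>\<epsilon>\<close> tend to 0 gives \<open>g s * h ^ k\<close>.\<close>
  have dir: "g s * h ^ k \<in> closure T"
    if h: "h = complex_of_real \<alpha> * s + complex_of_real \<beta> * v" "\<beta> > 0" for h \<alpha> \<beta>
  proof (rule Lim_in_closed_set[OF closed_closure])
    have sm: "((\<lambda>\<epsilon>::real. s + \<epsilon> * h) \<longlongrightarrow> s) (at_right 0)"
      by (auto intro!: tendsto_eq_intros)
    have "isCont g s" using g(2,3) continuous_on_interior[of "ball s r" g s]
      by (simp add: holomorphic_on_imp_continuous_on)
    from isCont_tendsto_compose[OF this sm]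
    show "((\<lambda>\<epsilon>::real. g (s + \<epsilon> * h) * h ^ k) \<longlongrightarrow> g s * h ^ k) (at_right 0)"
      by (intro tendsto_intros)
    have "\<forall>\<^sub>F \<epsilon>::real in at_right 0. dist (s + \<epsilon> * h) s < r"
      using tendstoD[OF sm g(2)] .
    moreover have "((\<lambda>\<epsilon>::real. 1 + \<epsilon> * \<alpha>) \<longlongrightarrow> 1) (at_right 0)"
      by (auto intro!: tendsto_eq_intros)
    then have "\<forall>\<^sub>F \<epsilon>::real in at_right 0. 0 < 1 + \<epsilon> * \<alpha>"
      by (rule order_tendstoD) simp
    moreover have "\<forall>\<^sub>F \<epsilon>::real in at_right 0. 0 < \<epsilon>" by (rule eventually_at_right_less)
    ultimately show "\<forall>\<^sub>F \<epsilon>::real in at_right 0. g (s + \<epsilon> * h) * h ^ k \<in> closure T"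
    proof eventually_elim
      case (elim \<epsilon>)
      have "complex_of_real (1 + \<epsilon> * \<alpha>) * s + complex_of_real (\<epsilon> * \<beta>) * v \<in> T"
        using elim h by (intro T_span v sT) auto
      also have "complex_of_real (1 + \<epsilon> * \<alpha>) * s + complex_of_real (\<epsilon> * \<beta>) * v = s + \<epsilon> * h"
        by (simp add: h algebra_simps)
      finally have "F (s + \<epsilon> * h) \<in> U" by (simp add: FU)
      then have "F (s + \<epsilon> * h) - z0 \<in> T" by (auto simp: T_def intro!: exI[of _ 1])
      then have "complex_of_real (1 / \<epsilon> ^ k) * (F (s + \<epsilon> * h) - z0) \<in> T"
        using elim by (intro T_scale) auto
      also have "F (s + \<epsilon> * h) - z0 = (\<epsilon> * h) ^ k * g (s + \<epsilon> * h)"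
        using g(4)[of "s + \<epsilon> * h"] elim by (simp add: dist_commute)
      also have "complex_of_real (1 / \<epsilon> ^ k) * \<dots> = g (s + \<epsilon> * h) * h ^ k"
        using elim by (simp add: power_mult_distrib)
      finally show ?case using closure_subset by blast
    qed
  qed (simp add: trivial_limit_at_right_real)
  \<comment> \<open>The limit case \<open>\<beta> = 0\<close> adds the directions along the
    boundary, in particular \<open>h = s\<close>.\<close>
  have dir': "g s * h ^ k \<in> closure T"
    if h: "h = complex_of_real \<alpha> * s + complex_of_real \<beta> * v" "\<beta> \<ge> 0" for h \<alpha> \<beta>
  proof (rule Lim_in_closed_set[OF closed_closure])
    show "((\<lambda>\<epsilon>::real. g s * (h + complex_of_real \<epsilon> * v) ^ k) \<longlongrightarrow> g s * h ^ k) (at_right 0)"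
      by (auto intro!: tendsto_eq_intros)
    have "\<forall>\<^sub>F \<epsilon>::real in at_right 0. 0 < \<epsilon>" by (rule eventually_at_right_less)
    then show "\<forall>\<^sub>F \<epsilon>::real in at_right 0. g s * (h + complex_of_real \<epsilon> * v) ^ k \<in> closure T"
      by eventually_elim (rule dir[of _ \<alpha> "\<beta> + _"], use h in \<open>auto simp: algebra_simps\<close>)
  qed (simp add: trivial_limit_at_right_real)
  text \<open>Two directions in the closed half disc at \<open>s\<close> whose \<open>k\<close>-th powers are opposite show that
    the closed tangent cone contains a full line.\<close>
  obtain x where x: "x \<noteq> 0" "x \<in> closure T" "- x \<in> closure T"
  proof -
    define \<zeta> where "\<zeta> = v / s"
    \<comment> \<open>If \<open>v\<close> were a real multiple of \<open>s\<close>, then scaling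
      \<open>v\<close>, or adding a nonnegative multiple of \<open>s\<close> to it, would put
      \<open>s\<close> into \<open>T\<close>.\<close>
    have "Im \<zeta> \<noteq> 0"
    proof
      assume "Im \<zeta> = 0"
      then have "\<zeta> = complex_of_real (Re \<zeta>)" by (simp add: complex_eq_iff)
      moreover have "v = \<zeta> * s" using s by (simp add: \<zeta>_def)
      ultimately have vs: "v = complex_of_real (Re \<zeta>) * s" by metis
      show False
      proof (cases "Re \<zeta> > 0")
        case True
        then have "complex_of_real (1 / Re \<zeta>) * v \<in> T" by (intro T_scale v) auto
        then show False using sT True by (subst (asm) vs) simp
      next
        case False
        have "complex_of_real (1 - Re \<zeta>) * s + complex_of_real 1 * v \<in> T"
          using False by (intro T_span v sT) auto
        also have "complex_of_real (1 - Re \<zeta>) * s + complex_of_real 1 * v = s"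
          by (subst vs) (simp add: algebra_simps)
        finally show False using sT by simp
      qed
    qed
    \<comment> \<open>The sign tells on which side of the line through \<open>s\<close> the vector
      \<open>v\<close> lies. Turning \<open>s\<close> to that side by
      \<open>\<theta> = pi / k\<close> reverses its \<open>k\<close>-th power;
      \<open>\<alpha>\<close> and \<open>\<beta>\<close> are the coordinates of the turned vector
      with respect to \<open>s\<close> and \<open>v\<close>.\<close>
    define \<sigma> where "\<sigma> = sgn (Im \<zeta>)"
    have \<sigma>: "\<sigma> / Im \<zeta> > 0" "\<sigma> = 1 \<or> \<sigma> = -1"
      using \<open>Im \<zeta> \<noteq> 0\<close> by (auto simp: \<sigma>_def sgn_if)
    define \<theta> where "\<theta> = pi / k"
    have \<theta>: "0 \<le> \<theta>" "\<theta> \<le> pi" "k * \<theta> = pi" using g(1) by (auto simp: \<theta>_def divide_le_eq)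
    define \<beta> where "\<beta> = \<sigma> * sin \<theta> / Im \<zeta>"
    define \<alpha> where "\<alpha> = cos \<theta> - \<beta> * Re \<zeta>"
    have "\<beta> \<ge> 0" using \<sigma>(1) sin_ge_zero[OF \<theta>(1,2)] by (simp add: \<beta>_def) (metis mult.commute mult_nonneg_nonneg less_imp_le times_divide_eq_left)
    have "cis (\<sigma> * \<theta>) = complex_of_real \<alpha> + complex_of_real \<beta> * \<zeta>"
      using \<sigma>(2) \<open>Im \<zeta> \<noteq> 0\<close> by (auto simp: complex_eq_iff \<alpha>_def \<beta>_def)
    then have "s * cis (\<sigma> * \<theta>) = complex_of_real \<alpha> * s + complex_of_real \<beta> * v"
      using s by (simp add: \<zeta>_def algebra_simps)
    from dir'[OF this \<open>\<beta> \<ge> 0\<close>] have "g s * (s * cis (\<sigma> * \<theta>)) ^ k \<in> closure T" .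
    moreover have "cis (\<sigma> * \<theta>) ^ k = -1"
    proof -
      have "cis (\<sigma> * \<theta>) ^ k = cis (\<sigma> * (k * \<theta>))" by (simp add: Complex.DeMoivre mult_ac)
      then show ?thesis using \<sigma>(2) by (auto simp: \<theta>(3) complex_eq_iff)
    qed
    ultimately have "- (g s * s ^ k) \<in> closure T" by (simp add: power_mult_distrib)
    moreover have "g s * s ^ k \<in> closure T" by (rule dir'[of s 1 0]) auto
    moreover have "g s * s ^ k \<noteq> 0" using g s by simp
    ultimately show thesis using that by blast
  qed
  obtain e where e: "e \<noteq> 0" "\<And>z. z \<in> U \<Longrightarrow> 0 < Re (e * (z - z0))"
    using supporting_line[OF z0(2)] by metis
  have eT: "0 < Re (e * y)" if y: "y \<in> T" for y
  proof -
    from y obtain t :: real where t: "t > 0" "z0 + t * y \<in> U" by (auto simp: T_def)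
    from e(2)[OF t(2)] have "0 < t * Re (e * y)" by (simp add: algebra_simps)
    then show ?thesis using t(1) by (simp add: zero_less_mult_iff)
  qed
  have ex: "Re (e * x) = 0"
  proof -
    have "closure T \<subseteq> {y. 0 \<le> Re (e * y)}"
      using eT by (intro closure_minimal closed_Collect_le continuous_intros) (auto intro: less_imp_le)
    then have cl: "0 \<le> Re (e * y)" if "y \<in> closure T" for y using that by blast
    from cl[OF x(2)] cl[OF x(3)] show ?thesis by simp
  qed
  \<comment> \<open>The line spanned by \<open>x\<close> must be the supporting one. Every
    \<open>y\<close> strictly beyond it is a positive multiple of \<open>v\<close> plus a real
    multiple of \<open>x\<close>, hence in the cone.\<close>
  have Teq: "T = {y. 0 < Re (e * y)}"
  proof (intro set_eqI iffI)
    fix y assume "y \<in> {y. 0 < Re (e * y)}"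
    then have y: "0 < Re (e * y)" by simp
    define \<beta> where "\<beta> = Re (e * y) / Re (e * v)"
    have \<beta>: "\<beta> > 0" using y eT[OF v] by (simp add: \<beta>_def)
    have "Re (e * (y - \<beta> * v)) = Re (e * y) - \<beta> * Re (e * v)" by (simp add: algebra_simps)
    then have 0: "Re (e * (y - \<beta> * v)) = 0" using eT[OF v] by (simp add: \<beta>_def)
    define \<alpha> where "\<alpha> = Im (e * (y - \<beta> * v)) / Im (e * x)"
    have "e * x \<noteq> 0" using x(1) e(1) by simp
    then have "Im (e * x) \<noteq> 0" using ex unfolding complex_eq_iff zero_complex.sel by blast
    moreover have "Y = complex_of_real (Im Y / Im X) * X" if "Re X = 0" "Re Y = 0" "Im X \<noteq> 0" for X Y
      using that by (simp add: complex_eq_iff)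
    ultimately have "e * (y - \<beta> * v) = complex_of_real \<alpha> * (e * x)"
      using 0 ex unfolding \<alpha>_def by blast
    then have "e * y = e * (complex_of_real \<alpha> * x + \<beta> * v)" by (simp add: algebra_simps)
    then have "y = complex_of_real \<alpha> * x + \<beta> * v" using e(1) by simp
    then show "y \<in> T" using T_span[OF v \<beta> x(2)] x(3) by simp
  qed (use eT in simp)
  have clT: "closure T = {y. 0 \<le> Re (e * y)}"
  proof -
    have "{y. 0 < Re (e * y)} = {y. cnj e \<bullet> y > 0}" "{y. 0 \<le> Re (e * y)} = {y. cnj e \<bullet> y \<ge> 0}"
      by (auto simp: inner_complex_def)
    then show ?thesis using closure_halfspace_gt[of "cnj e" 0] e(1) by (simp add: Teq)
  qed
  show thesis
  \<comment> \<open>The rotation makes \<open>Re (e * y)\<close> equal to \<open>- Im z\<close>.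
    Precomposing with a linear map keeps the functional equation.\<close>
  proof (rule that[of "\<lambda>z. F (\<i> * z / e)"])
    show "(\<lambda>z. F (\<i> * z / e)) holomorphic_on UNIV"
    proof -
      have "(\<lambda>z. \<i> * z / e) holomorphic_on UNIV" using e(1) by (intro holomorphic_intros) auto
      from holomorphic_on_compose_gen[OF this F(1)] show ?thesis by (simp add: o_def)
    qed
    show "F (\<i> * (m * z) / e) = f (F (\<i> * z / e))" for z
      using F(2)[of "\<i> * z / e"] by (simp add: mult_ac)
    have "e * (\<i> * z / e) = \<i> * z" for z using e(1) by simp
    then have Re: "Re (e * (\<i> * z / e)) = - Im z" for z by (simp only:) simp
    show "F (\<i> * z / e) \<in> U \<longleftrightarrow> Im z < 0" for z
      unfolding FU Teq mem_Collect_eq Re by simp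
    show "F (\<i> * z / e) \<in> K \<longleftrightarrow> Im z \<le> 0" for z
      unfolding FK clT mem_Collect_eq Re by simp
  qed
qed

end

subsection \<open>The Boettcher function outside the filled Julia set\<close>

lemma cmod_diff_ge_of_notin_ball:
  assumes "ball b e \<subseteq> U" "w \<notin> U"
  shows "e \<le> cmod (w - b)"
proof (rule leI, rule notI)
  assume "cmod (w - b) < e"
  then have "w \<in> ball b e" by (simp add: dist_norm norm_minus_commute)
  then show False using assms by blast
qed

lemma cmod_Ln_le: "cmod (Ln z) \<le> \<bar>ln (cmod z)\<bar> + pi" if "z \<noteq> 0"
proof -
  have "cmod (Ln z) \<le> \<bar>Re (Ln z)\<bar> + \<bar>Im (Ln z)\<bar>" by (rule cmod_le)
  also have "Re (Ln z) = ln (cmod z)" using that by simp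
  also have "\<bar>Im (Ln z)\<bar> \<le> pi" using mpi_less_Im_Ln[OF that] Im_Ln_le_pi[OF that] by linarith
  finally show ?thesis by simp
qed

context convex_filled_julia
begin

abbreviation "d \<equiv> degree p"

text \<open>For \<open>w\<close> outside \<open>U\<close> and \<open>r, c \<in> U\<close> the quotient \<open>(w - r) / (w - c)\<close> is not a negative
  real, since \<open>w\<close> is not on the segment from \<open>r\<close> to \<open>c\<close>; hence the principal logarithm can be
  used on all of the complement of \<open>U\<close>.\<close>

lemma quotient_log:
  assumes o: "c \<in> U" "r \<in> U"
  obtains L M where "continuous_on (- U) L" "L holomorphic_on (- K)"
    "\<And>w. w \<notin> U \<Longrightarrow> w - r = (w - c) * exp (L w)" "\<And>w. w \<notin> U \<Longrightarrow> cmod (L w) \<le> M"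
proof -
  define q where "q w = (w - r) / (w - c)" for w
  have nz: "w - c \<noteq> 0" "w - r \<noteq> 0" if "w \<notin> U" for w using that o by auto
  have slit: "q w \<notin> \<real>\<^sub>\<le>\<^sub>0" if w: "w \<notin> U" for w
  proof
    assume "q w \<in> \<real>\<^sub>\<le>\<^sub>0"
    then obtain s where s: "q w = complex_of_real s" "s \<le> 0" by (auto elim!: nonpos_Reals_cases)
    then have "w - r = s * (w - c)" using nz[OF w] by (simp add: q_def divide_eq_eq)
    then have "complex_of_real (1 - s) * w = r - s * c" by (simp add: algebra_simps)
    then have "w = (r - s * c) / complex_of_real (1 - s)"
      using s(2) by (simp add: eq_divide_eq mult.commute del: of_real_diff)
    also have "\<dots> = (1 / (1 - s)) *\<^sub>R r + (- s / (1 - s)) *\<^sub>R c"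
      by (simp add: scaleR_conv_of_real diff_divide_distrib)
    also have "\<dots> \<in> U"
      using s(2) o by (intro convexD[OF convex_U]) (auto simp: divide_simps)
    finally show False using w by simp
  qed
  \<comment> \<open>Applied to both orders of the two points, this bounds the quotient from above
    and away from 0, and so its logarithm.\<close>
  have bound: "\<exists>C. C \<ge> 1 \<and> (\<forall>w. w \<notin> U \<longrightarrow> cmod ((w - a) / (w - b)) \<le> C)"
    if ab: "a \<in> U" "b \<in> U" for a b
  proof -
    obtain e where e: "e > 0" "ball b e \<subseteq> U" using open_U ab open_contains_ball by blast
    have "cmod ((w - a) / (w - b)) \<le> 1 + cmod (b - a) / e" if w: "w \<notin> U" for w
    proof -
      have we: "e \<le> cmod (w - b)" using cmod_diff_ge_of_notin_ball[OF e(2) w] .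
      have "(w - a) / (w - b) = 1 + (b - a) / (w - b)" using we e(1) by (auto simp: divide_simps)
      then have "cmod ((w - a) / (w - b)) \<le> 1 + cmod (b - a) / cmod (w - b)"
        using norm_triangle_ineq[of 1 "(b - a) / (w - b)"] by (simp add: norm_divide)
      also have "cmod (b - a) / cmod (w - b) \<le> cmod (b - a) / e"
        using we e(1) by (intro divide_left_mono mult_pos_pos) auto
      finally show ?thesis by simp
    qed
    moreover have "1 + cmod (b - a) / e \<ge> 1" using e by simp
    ultimately show ?thesis by blast
  qed
  obtain C1 C2 where C: "C1 \<ge> 1" "C2 \<ge> 1"
    "\<And>w. w \<notin> U \<Longrightarrow> cmod ((w - r) / (w - c)) \<le> C1"
    "\<And>w. w \<notin> U \<Longrightarrow> cmod ((w - c) / (w - r)) \<le> C2"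
    using bound[OF o(2,1)] bound[OF o] by blast
  define M where "M = ln C1 + ln C2 + pi"
  show thesis
  proof (rule that[of "\<lambda>w. Ln (q w)" M])
    have "continuous_on (- U) q" unfolding q_def using o by (intro continuous_intros) auto
    then show "continuous_on (- U) (\<lambda>w. Ln (q w))"
      using slit by (intro continuous_on_Ln') auto
    show "(\<lambda>w. Ln (q w)) holomorphic_on (- K)"
      using slit U_subset_K o unfolding q_def[abs_def] by (intro holomorphic_intros) auto
    fix w assume w: "w \<notin> U"
    have q0: "q w \<noteq> 0" using nz[OF w] by (simp add: q_def)
    then show "w - r = (w - c) * exp (Ln (q w))" using nz[OF w] by (simp add: q_def)
    have "\<bar>ln (cmod (q w))\<bar> \<le> ln C1 + ln C2"
    proof -
      have "ln (cmod (q w)) \<le> ln C1"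
        using C(3)[OF w] q0 C(1) by (simp add: q_def del: norm_divide norm_mult)
      moreover have "ln (cmod (inverse (q w))) \<le> ln C2"
        using C(4)[OF w] q0 C(2) nz[OF w] by (simp add: q_def norm_divide)
      then have "- ln (cmod (q w)) \<le> ln C2" using q0 by (simp add: norm_inverse ln_inverse)
      moreover have "ln C1 \<ge> 0" "ln C2 \<ge> 0" using C by auto
      ultimately show ?thesis by linarith
    qed
    then show "cmod (Ln (q w)) \<le> M" using cmod_Ln_le[OF q0] by (simp add: M_def)
  qed
qed

text \<open>As \<open>c\<close> is in \<open>U\<close>, invariance puts all roots of
  \<open>f - c\<close> into \<open>U\<close>, so \<open>quotient_log\<close> applies to each root.
  The sum of these logarithms with multiplicities, together with that of the leading coefficient, is
  the required logarithm.\<close>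

lemma quotient_log_poly:
  assumes c: "c \<in> U"
  obtains L M where "continuous_on (- U) L" "L holomorphic_on (- K)"
    "\<And>w. w \<notin> U \<Longrightarrow> f w - c = (w - c) ^ d * exp (L w)" "\<And>w. w \<notin> U \<Longrightarrow> cmod (L w) \<le> M"
proof -
  define q where "q = p - [:c:]"
  have fq: "poly q w = f w - c" for w by (simp add: q_def)
  have dq: "degree q = d"
    using degree_add_eq_left[of "- [:c:]" p] degree_ge_2 by (simp add: q_def del: minus_pCons)
  then have "q \<noteq> 0" using degree_ge_2 by auto
  then have q0: "q \<noteq> 0" "lead_coeff q \<noteq> 0" by auto
  define Z where "Z = {z. poly q z = 0}"
  have finZ: "finite Z" unfolding Z_def using q0 by (intro poly_roots_finite)
  have ZU: "r \<in> U" if "r \<in> Z" for r using that c f_in_U_iff[of r] by (simp add: Z_def fq)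
  have dec: "smult (lead_coeff q) (\<Prod>z\<in>Z. [:- z, 1:] ^ order z q) = q"
    unfolding Z_def by (rule complex_poly_decompose)
  have "degree (\<Prod>z\<in>Z. [:- z, 1:] ^ order z q) = (\<Sum>z\<in>Z. order z q)"
    by (subst degree_prod_eq_sum_degree) (auto simp: degree_power_eq)
  then have sum: "(\<Sum>z\<in>Z. order z q) = d" using arg_cong[OF dec, of degree] q0 dq by simp
  have "\<forall>r\<in>Z. \<exists>L M. continuous_on (- U) L \<and> L holomorphic_on (- K) \<and>
      (\<forall>w. w \<notin> U \<longrightarrow> w - r = (w - c) * exp (L w)) \<and> (\<forall>w. w \<notin> U \<longrightarrow> cmod (L w) \<le> M)"
    using quotient_log[OF c ZU] by metis
  then obtain L M where LM: "\<And>r. r \<in> Z \<Longrightarrow> continuous_on (- U) (L r)"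
      "\<And>r. r \<in> Z \<Longrightarrow> L r holomorphic_on (- K)"
      "\<And>r w. r \<in> Z \<Longrightarrow> w \<notin> U \<Longrightarrow> w - r = (w - c) * exp (L r w)"
      "\<And>r w. r \<in> Z \<Longrightarrow> w \<notin> U \<Longrightarrow> cmod (L r w) \<le> M r"
    by metis
  define H where "H w = Ln (lead_coeff q) + (\<Sum>r\<in>Z. of_nat (order r q) * L r w)" for w
  show thesis
  proof (rule that[of H "cmod (Ln (lead_coeff q)) + (\<Sum>r\<in>Z. real (order r q) * M r)"])
    show "continuous_on (- U) H" unfolding H_def by (intro continuous_intros LM)
    show "H holomorphic_on (- K)" unfolding H_def[abs_def] by (intro holomorphic_intros LM)
    fix w assume w: "w \<notin> U"
    have "f w - c = lead_coeff q * (\<Prod>r\<in>Z. (w - r) ^ order r q)"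
      using arg_cong[OF dec, of "\<lambda>q. poly q w"] by (simp add: fq poly_prod)
    also have "(\<Prod>r\<in>Z. (w - r) ^ order r q) = (\<Prod>r\<in>Z. ((w - c) * exp (L r w)) ^ order r q)"
      using LM(3) w by (intro prod.cong refl) metis
    also have "\<dots> = (w - c) ^ d * exp (\<Sum>r\<in>Z. of_nat (order r q) * L r w)"
      using finZ by (simp add: power_mult_distrib prod.distrib exp_sum exp_of_nat_mult power_sum sum[symmetric])
    finally show "f w - c = (w - c) ^ d * exp (H w)"
      using q0 by (simp add: H_def exp_add)
    have "cmod (H w) \<le> cmod (Ln (lead_coeff q)) + cmod (\<Sum>r\<in>Z. of_nat (order r q) * L r w)"
      unfolding H_def by (rule norm_triangle_ineq)
    also have "cmod (\<Sum>r\<in>Z. of_nat (order r q) * L r w) \<le> (\<Sum>r\<in>Z. real (order r q) * M r)"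
      using LM(4) w by (intro sum_norm_le) (auto simp: norm_mult intro!: mult_left_mono)
    finally show "cmod (H w) \<le> cmod (Ln (lead_coeff q)) + (\<Sum>r\<in>Z. real (order r q) * M r)" by simp
  qed
qed

text \<open>The series for \<open>\<Theta>\<close> converges uniformly up to the frontier of
  \<open>U\<close>, so \<open>B w\<close> and \<open>w - c\<close> are comparable in modulus. With
  \<open>B (f w) = B w ^ d\<close>, a modulus below 1 would drive the orbit to \<open>c\<close>,
  which orbits outside \<open>U\<close> cannot approach; a modulus above 1 would make it escape,
  which points of \<open>K\<close> cannot do.\<close>

lemma boettcher_function:
  obtains B c M R where "c \<in> U" "M > 0" "continuous_on (- U) B" "B holomorphic_on (- K)"
    "\<And>w. w \<notin> U \<Longrightarrow> B (f w) = B w ^ d"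
    "\<And>w. w \<notin> U \<Longrightarrow> 1 \<le> cmod (B w)" "\<And>w. w \<notin> U \<Longrightarrow> w \<in> K \<Longrightarrow> cmod (B w) = 1"
    "\<And>w. w \<notin> U \<Longrightarrow> cmod (w - c) \<le> M * cmod (B w)" "\<And>w. w \<notin> U \<Longrightarrow> cmod (B w) \<le> M * cmod (w - c)"
    "inj_on B {w. R < cmod (w - c)}"
proof -
  obtain c where c: "c \<in> U" using interior_K by blast
  obtain L M where L: "continuous_on (- U) L" "L holomorphic_on (- K)"
      "\<And>w. w \<notin> U \<Longrightarrow> f w - c = (w - c) ^ d * exp (L w)" "\<And>w. w \<notin> U \<Longrightarrow> cmod (L w) \<le> M"
    using quotient_log_poly[OF c] by metis
  have d2: "d > 1" "d > 0" using degree_ge_2 by auto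
  have "bounded U" using bounded_K by (rule bounded_interior)
  then have "U \<noteq> UNIV" using not_bounded_UNIV by force
  then obtain b where "b \<notin> U" by blast
  then have M0: "M \<ge> 0" using L(4) norm_ge_zero order_trans by blast
  \<comment> \<open>Formally \<open>B w\<close> is the limit of the \<open>d ^ n\<close>-th roots of
    \<open>f^n w - c\<close>. In logarithms, each application of \<open>quotient_log_poly\<close>
    adds one term \<open>t n w\<close> to \<open>log (w - c)\<close>.\<close>
  define t where "t n w = L ((f ^^ n) w) / of_nat d ^ Suc n" for n w
  define \<Theta> where "\<Theta> w = (\<Sum>n. t n w)" for w
  have tb: "cmod (t n w) \<le> M * (1 / real d) ^ Suc n" if "w \<notin> U" for n w
    using L(4)[of "(f ^^ n) w"] that d2
    by (simp add: t_def norm_divide norm_mult norm_power field_simps)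
  have sumM: "summable (\<lambda>n. M * (1 / real d) ^ Suc n)"
    using d2 by (intro summable_mult summable_geometric[THEN summable_ignore_initial_segment[of _ 1, simplified]]) auto
  have ul: "uniform_limit (- U) (\<lambda>n w. \<Sum>i<n. t i w) \<Theta> sequentially"
    unfolding \<Theta>_def by (rule Weierstrass_m_test[OF _ sumM]) (use tb in auto)
  have contfn: "continuous_on S (f ^^ n)" for n S
    by (induction n) (auto intro!: continuous_intros continuous_on_compose simp: o_def)
  have holfn: "(f ^^ n) holomorphic_on S" for n S
    by (induction n) (auto intro!: holomorphic_intros simp: o_def id_def)
  have contt: "continuous_on (- U) (t n)" for n
    unfolding t_def[abs_def] using d2
    by (intro continuous_intros continuous_on_compose2[OF L(1) contfn]) auto
  have holt: "t n holomorphic_on (- K)" for n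
  proof -
    have "(L \<circ> (f ^^ n)) holomorphic_on (- K)"
      by (rule holomorphic_on_compose_gen[OF holfn L(2)]) auto
    then show ?thesis
      unfolding t_def[abs_def] o_def using d2 by (intro holomorphic_intros) auto
  qed
  have cont\<Theta>: "continuous_on (- U) \<Theta>"
    by (rule uniform_limit_theorem[OF _ ul]) (auto intro!: always_eventually continuous_intros contt)
  have hol\<Theta>: "\<Theta> holomorphic_on (- K)"
  proof (rule holomorphic_uniform_sequence)
    show "open (- K)" using closed_K by (simp add: open_Compl)
    show "(\<lambda>w. \<Sum>i<n. t i w) holomorphic_on - K" for n by (intro holomorphic_intros holt)
    fix x assume "x \<in> - K"
    then obtain e where e: "e > 0" "cball x e \<subseteq> - K"
      using closed_K open_Compl open_contains_cball by meson
    then show "\<exists>e>0. cball x e \<subseteq> - K \<and> uniform_limit (cball x e) (\<lambda>n w. \<Sum>i<n. t i w) \<Theta> sequentially"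
      using uniform_limit_on_subset[OF ul, of "cball x e"] U_subset_K by blast
  qed
  have summ: "summable (\<lambda>n. t n w)" if "w \<notin> U" for w
    by (rule summable_comparison_test'[OF sumM]) (use tb that in auto)
  define M' where "M' = (\<Sum>n. M * (1 / real d) ^ Suc n)"
  have \<Theta>b: "cmod (\<Theta> w) \<le> M'" if "w \<notin> U" for w
    unfolding \<Theta>_def M'_def by (rule norm_suminf_le[OF _ sumM]) (use tb that in auto)
  have \<Theta>f: "\<Theta> (f w) = of_nat d * \<Theta> w - L w" if w: "w \<notin> U" for w
  proof -
    have "\<Theta> w = t 0 w + (\<Sum>n. t (Suc n) w)"
      unfolding \<Theta>_def using suminf_split_head[OF summ[OF w]] by simp
    also have "(\<lambda>n. t (Suc n) w) = (\<lambda>n. t n (f w) / of_nat d)"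
      by (simp add: t_def funpow_swap1 fun_eq_iff)
    also have "(\<Sum>n. t n (f w) / of_nat d) = \<Theta> (f w) / of_nat d"
      unfolding \<Theta>_def using summ[of "f w"] w by (intro suminf_divide) auto
    also have "t 0 w = L w / of_nat d" by (simp add: t_def)
    finally show ?thesis using d2 by (simp add: field_simps)
  qed
  define B where "B w = (w - c) * exp (\<Theta> w)" for w
  have Bf: "B (f w) = B w ^ d" if w: "w \<notin> U" for w
    using L(3)[OF w] by (simp add: B_def \<Theta>f[OF w] exp_diff exp_of_nat_mult power_mult_distrib)
  have Bfn: "B ((f ^^ n) w) = B w ^ (d ^ n)" if w: "w \<notin> U" for n w
    by (induction n) (use w in \<open>auto simp: Bf power_mult[symmetric] mult.commute\<close>)
  define N where "N = exp M'"
  have N: "N > 0" by (simp add: N_def)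
  have expb: "exp (Re (\<Theta> w)) \<le> N" "exp (- Re (\<Theta> w)) \<le> N" if w: "w \<notin> U" for w
    using \<Theta>b[OF w] abs_Re_le_cmod[of "\<Theta> w"] by (auto simp: N_def)
  have up: "cmod (B w) \<le> N * cmod (w - c)" if w: "w \<notin> U" for w
    using mult_right_mono[OF expb(1)[OF w], of "cmod (w - c)"] by (simp add: B_def norm_mult mult.commute)
  have lo: "cmod (w - c) \<le> N * cmod (B w)" if w: "w \<notin> U" for w
  proof -
    have "cmod (w - c) = exp (- Re (\<Theta> w)) * cmod (B w)"
      by (simp add: B_def norm_mult exp_minus)
    also have "\<dots> \<le> N * cmod (B w)" using expb(2)[OF w] by (intro mult_right_mono) auto
    finally show ?thesis .
  qed
  have dn: "filterlim (\<lambda>n. d ^ n) at_top sequentially"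
  proof (rule filterlim_at_top_mono)
    show "filterlim (\<lambda>n. n) at_top sequentially" by (rule filterlim_ident)
    show "\<forall>\<^sub>F n in sequentially. n \<le> d ^ n"
      using less_exp power_mono[of 2 d] degree_ge_2 by (intro always_eventually allI) (meson less_imp_le order_trans zero_le_numeral)
  qed
  have B1: "1 \<le> cmod (B w)" if w: "w \<notin> U" for w
  proof (rule ccontr)
    assume "\<not> 1 \<le> cmod (B w)"
    then have lt: "cmod (B w) < 1" by simp
    obtain e where e: "e > 0" "ball c e \<subseteq> U" using open_U c open_contains_ball by blast
    have low: "e / N \<le> cmod (B w) ^ (d ^ n)" for n
    proof -
      have "(f ^^ n) w \<notin> U" using w by simp
      then have "e \<le> cmod ((f ^^ n) w - c)" by (rule cmod_diff_ge_of_notin_ball[OF e(2)])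
      also have "\<dots> \<le> N * cmod (B ((f ^^ n) w))" using w by (intro lo) auto
      finally show ?thesis using N by (simp add: Bfn[OF w] norm_power divide_le_eq mult.commute)
    qed
    have "(\<lambda>n. cmod (B w) ^ n) \<longlonglongrightarrow> 0" using lt by (intro LIMSEQ_power_zero) auto
    from filterlim_compose[OF this dn] have "(\<lambda>n. cmod (B w) ^ (d ^ n)) \<longlonglongrightarrow> 0" .
    from LIMSEQ_le_const[OF this] low have "e / N \<le> 0" by blast
    then show False using e N by (simp add: divide_le_0_iff)
  qed
  have B2: "cmod (B w) = 1" if w: "w \<notin> U" "w \<in> K" for w
  proof (rule antisym[OF _ B1[OF w(1)]])
    obtain b where b: "\<And>z. z \<in> K \<Longrightarrow> cmod z \<le> b" using K_bounded by blast
    have high: "cmod (B w) ^ (d ^ n) \<le> N * (b + cmod c)" for n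
    proof -
      have "cmod (B ((f ^^ n) w)) \<le> N * cmod ((f ^^ n) w - c)" using w by (intro up) auto
      also have "cmod ((f ^^ n) w - c) \<le> b + cmod c"
        using b[of "(f ^^ n) w"] w norm_triangle_ineq4[of "(f ^^ n) w" c] by auto
      finally show ?thesis using N by (simp add: Bfn[OF w(1)] norm_power)
    qed
    show "cmod (B w) \<le> 1"
    proof (rule ccontr)
      assume "\<not> cmod (B w) \<le> 1"
      then have gt: "1 < cmod (B w)" by simp
      obtain n where n: "N * (b + cmod c) < cmod (B w) ^ n" using real_arch_pow[OF gt] by blast
      have "n \<le> d ^ n" using less_exp[of n] power_mono[of 2 d n] degree_ge_2 by linarith
      then have "cmod (B w) ^ n \<le> cmod (B w) ^ (d ^ n)" using gt by (intro power_increasing) auto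
      then show False using n high[of n] by linarith
    qed
  qed
  obtain R where "inj_on B {w. R < cmod (w - c)}"
  proof -
    obtain b where b: "\<And>z. z \<in> K \<Longrightarrow> cmod z \<le> b" "b > 0" using K_bounded by metis
    define R0 where "R0 = b + cmod c"
    have R0: "R0 > 0" using b by (simp add: R0_def add_pos_nonneg)
    have outK: "w \<notin> K" if "R0 < cmod (w - c)" for w
      using b(1)[of w] that norm_triangle_ineq4[of w c] by (auto simp: R0_def)
    have out: "c + 1 / u \<notin> K" if "u \<in> ball 0 (1 / R0) - {0}" for u
    proof (rule outK)
      have "cmod u < 1 / R0" "cmod u > 0" using that by auto
      then show "R0 < cmod (c + 1 / u - c)" using R0 by (simp add: norm_divide field_simps)
    qed
    \<comment> \<open>In the coordinate \<open>u = 1 / (w - c)\<close> at infinity the singularity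
      of \<open>\<Theta>\<close> is removable, as \<open>\<Theta>\<close> is bounded. So
      \<open>1 / B\<close> becomes \<open>u * exp (- g u)\<close>, with nonzero derivative at 0,
      hence locally injective.\<close>
    define \<Phi> where "\<Phi> u = \<Theta> (c + 1 / u)" for u
    have "\<Theta> \<circ> (\<lambda>u. c + 1 / u) holomorphic_on ball 0 (1 / R0) - {0}"
      using out by (intro holomorphic_on_compose_gen[OF _ hol\<Theta>] holomorphic_intros) auto
    then have hol\<Phi>: "\<Phi> holomorphic_on ball 0 (1 / R0) - {0}" by (simp add: o_def \<Phi>_def[abs_def])
    have "\<forall>\<^sub>F u in at 0. u \<in> ball (0::complex) (1 / R0) - {0}"
      using R0 by (auto simp: eventually_at intro!: exI[of _ "1 / R0"])
    then have "\<forall>\<^sub>F u in at 0. cmod (\<Phi> u) \<le> M'"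
      by eventually_elim (use out U_subset_K in \<open>auto simp: \<Phi>_def intro!: \<Theta>b\<close>)
    then obtain g where g: "g holomorphic_on ball 0 (1 / R0)" "\<And>u. u \<in> ball 0 (1 / R0) - {0} \<Longrightarrow> g u = \<Phi> u"
      using holomorphic_on_extend_bounded[OF hol\<Phi>] R0 by auto
    define k where "k u = u * exp (- g u)" for u
    have holk: "k holomorphic_on ball 0 (1 / R0)" unfolding k_def[abs_def] by (intro holomorphic_intros g)
    have "(g has_field_derivative deriv g 0) (at 0)"
      using R0 by (intro holomorphic_derivI[OF g(1)]) auto
    then have "(k has_field_derivative exp (- g 0)) (at 0)"
      unfolding k_def[abs_def] by (auto intro!: derivative_eq_intros)
    then have "deriv k 0 = exp (- g 0)" by (rule DERIV_imp_deriv)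
    then have dk: "deriv k 0 \<noteq> 0" by simp
    have in0: "0 \<in> ball (0::complex) (1 / R0)" using R0 by simp
    obtain \<rho> where \<rho>: "\<rho> > 0" "ball (0::complex) \<rho> \<subseteq> ball 0 (1 / R0)" "inj_on k (ball 0 \<rho>)"
      by (rule has_complex_derivative_locally_injective[OF holk in0 open_ball dk]) blast
    show thesis
    proof (rule that[of "1 / \<rho>"], rule inj_onI)
      fix w w' assume w: "w \<in> {w. 1 / \<rho> < cmod (w - c)}" "w' \<in> {w. 1 / \<rho> < cmod (w - c)}"
        and eq: "B w = B w'"
      have *: "1 / (v - c) \<in> ball 0 \<rho> \<and> k (1 / (v - c)) = 1 / B v \<and> v \<noteq> c" if "v \<in> {w. 1 / \<rho> < cmod (w - c)}" for v
      proof -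
        have v: "1 / \<rho> < cmod (v - c)" using that by simp
        have "0 < 1 / \<rho>" using \<rho>(1) by simp
        then have v0: "0 < cmod (v - c)" using v by linarith
        then have inb: "1 / (v - c) \<in> ball 0 \<rho>" using v \<rho>(1) by (simp add: norm_divide field_simps)
        then have "1 / (v - c) \<in> ball 0 (1 / R0) - {0}" using \<rho>(2) v0 by auto
        from g(2)[OF this] have "g (1 / (v - c)) = \<Theta> v" by (simp add: \<Phi>_def)
        then show ?thesis using inb v0 by (auto simp: k_def B_def exp_minus divide_simps)
      qed
      have "k (1 / (w - c)) = k (1 / (w' - c))" using *[OF w(1)] *[OF w(2)] eq by simp
      then have "1 / (w - c) = 1 / (w' - c)" using *[OF w(1)] *[OF w(2)] inj_onD[OF \<rho>(3)] by blast
      then show "w = w'" using *[OF w(1)] *[OF w(2)] by (simp add: frac_eq_eq)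
    qed
  qed
  moreover have "continuous_on (- U) B" unfolding B_def[abs_def] by (intro continuous_intros cont\<Theta>)
  moreover have "B holomorphic_on (- K)" unfolding B_def[abs_def] by (intro holomorphic_intros hol\<Theta>)
  ultimately show thesis using that[of c N B R] c N Bf B1 B2 lo up by blast
qed

end

subsection \<open>Functions on a half plane\<close>

text \<open>Near \<open>z\<close> the values of \<open>L\<close> differ from \<open>L z\<close> by
  less than pi in imaginary part, so that \<open>L\<close> agrees there with \<open>L z\<close> plus
  the principal logarithm of \<open>G w / G z\<close>.\<close>

lemma continuous_log_imp_holomorphic:
  fixes G L :: "complex \<Rightarrow> complex"
  assumes S: "open S" and L: "continuous_on S L" and G: "G holomorphic_on S"
    and eq: "\<And>z. z \<in> S \<Longrightarrow> G z = exp (L z)"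
  shows "L holomorphic_on S"
  unfolding holomorphic_on_def
proof
  fix z assume z: "z \<in> S"
  have "isCont L z" using L S z by (simp add: continuous_on_eq_continuous_at)
  then have "\<forall>\<^sub>F w in at z. dist (L w) (L z) < 1" unfolding isCont_def by (rule tendstoD) simp
  moreover have "\<forall>\<^sub>F w in at z. w \<in> S" using S z by (rule eventually_at_in_open')
  ultimately have "\<forall>\<^sub>F w in at z. dist (L w) (L z) < 1 \<and> w \<in> S" by (rule eventually_conj)
  then obtain e where e: "e > 0" "\<And>w. w \<noteq> z \<Longrightarrow> dist w z < e \<Longrightarrow> dist (L w) (L z) < 1 \<and> w \<in> S"
    unfolding eventually_at by auto
  have near: "\<bar>Im (L w - L z)\<bar> < 1" "w \<in> S" if w: "w \<in> ball z e" for w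
  proof -
    have "dist (L w) (L z) < 1 \<and> w \<in> S"
      using e(2)[of w] w z by (cases "w = z") (auto simp: dist_commute)
    then show "\<bar>Im (L w - L z)\<bar> < 1" "w \<in> S"
      using abs_Im_le_cmod[of "L w - L z"] by (auto simp: dist_norm)
  qed
  have quot: "G w / G z = exp (L w - L z)" if "w \<in> ball z e" for w
    using near(2)[OF that] z by (simp add: eq exp_diff)
  have slit: "G w / G z \<notin> \<real>\<^sub>\<le>\<^sub>0" if w: "w \<in> ball z e" for w
  proof -
    have "cos (Im (L w - L z)) > 0"
      using near(1)[OF w] pi_gt3 by (intro cos_gt_zero_pi) auto
    then have "Re (exp (L w - L z)) > 0" by (simp only: Re_exp) simp
    then show ?thesis unfolding quot[OF w] complex_nonpos_Reals_iff by linarith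
  qed
  have "(\<lambda>w. L z + Ln (G w / G z)) holomorphic_on ball z e"
    using slit near(2) eq[OF z]
    by (intro holomorphic_intros holomorphic_on_subset[OF G]) auto
  moreover have "L z + Ln (G w / G z) = L w" if w: "w \<in> ball z e" for w
    using near(1)[OF w] pi_gt3 unfolding quot[OF w] by (subst Ln_exp) auto
  ultimately have "L holomorphic_on ball z e" using holomorphic_transform by blast
  then show "L field_differentiable at z within S"
    using e(1) holomorphic_on_imp_differentiable_at field_differentiable_at_within
    by (metis centre_in_ball open_ball)
qed

lemma homogeneous_entire:
  fixes \<Lambda> :: "complex \<Rightarrow> complex" and \<mu> :: real
  assumes hol: "\<Lambda> holomorphic_on UNIV" and \<mu>: "\<mu> > 1" and d: "d > 1"
    and hom: "\<And>z. \<Lambda> (complex_of_real \<mu> * z) = complex_of_real d * \<Lambda> z"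
    and nz: "\<Lambda> z1 \<noteq> 0"
  obtains n a where "n > 0" "a \<noteq> 0" "d = \<mu> ^ n" "\<And>z. \<Lambda> z = a * z ^ n"
proof -
  define m where "m = complex_of_real \<mu>"
  have m: "cmod m > 1" "m \<noteq> 0" using \<mu> by (auto simp: m_def)
  have "\<Lambda> 0 = complex_of_real d * \<Lambda> 0" using hom[of 0] by simp
  then have L0: "\<Lambda> 0 = 0" using d by simp
  have "\<not> \<Lambda> constant_on UNIV" using L0 nz unfolding constant_on_def by (metis UNIV_I)
  then obtain g r n where g: "0 < n" "0 < r" "g holomorphic_on ball 0 r"
      "\<And>w. w \<in> ball 0 r \<Longrightarrow> \<Lambda> w = (w - 0) ^ n * g w" "\<And>w. w \<in> ball 0 r \<Longrightarrow> g w \<noteq> 0"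
    by (rule holomorphic_factor_zero_nonconstant[OF hol open_UNIV connected_UNIV UNIV_I L0]) blast
  have "isCont g 0" using g(2,3) continuous_on_interior[of "ball 0 r" g 0]
    by (simp add: holomorphic_on_imp_continuous_on)
  have pow: "(\<lambda>k. z / m ^ k) \<longlonglongrightarrow> 0" for z
  proof -
    have "cmod (inverse m) < 1" using m by (metis inverse_less_1_iff norm_inverse)
    then have "(\<lambda>k. inverse m ^ k) \<longlonglongrightarrow> 0" by (rule LIMSEQ_power_zero)
    then have "(\<lambda>k. z * inverse m ^ k) \<longlonglongrightarrow> z * 0" by (intro tendsto_mult tendsto_const)
    then show ?thesis by (simp add: divide_inverse flip: power_inverse)
  qed
  have homk: "\<Lambda> z = complex_of_real d ^ k * \<Lambda> (z / m ^ k)" for z k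
  proof (induction k)
    case (Suc k)
    have "\<Lambda> (z / m ^ k) = complex_of_real d * \<Lambda> (z / m ^ Suc k)"
      using hom[of "z / m ^ Suc k"] m(2) by (simp add: m_def)
    then show ?case using Suc by simp
  qed simp
  text \<open>Near 0, \<open>\<Lambda> z = z ^ n * g z\<close>, and letting \<open>k \<rightarrow> \<infinity>\<close> in the functional equation replaces
    \<open>g\<close> by \<open>g 0\<close>.\<close>
  have glim: "(\<lambda>k. g (z / m ^ k)) \<longlonglongrightarrow> g 0" for z
    using isCont_tendsto_compose[OF \<open>isCont g 0\<close> pow] .
  have g_eq: "\<forall>\<^sub>F k in sequentially. \<Lambda> z = (complex_of_real d / m ^ n) ^ k * z ^ n * g (z / m ^ k)" for z
  proof -
    have "\<forall>\<^sub>F k in sequentially. dist (z / m ^ k) 0 < r" using tendstoD[OF pow g(2)] .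
    then show ?thesis
    proof eventually_elim
      case (elim k)
      have "\<Lambda> z = complex_of_real d ^ k * ((z / m ^ k) ^ n * g (z / m ^ k))"
        using homk[of z k] g(4)[of "z / m ^ k"] elim by simp
      then show ?case by (simp add: power_divide power_mult[symmetric] mult.commute)
    qed
  qed
  have dn: "complex_of_real d = m ^ n"
  proof -
    \<comment> \<open>Any nonzero sample point would do: comparing \<open>\<Lambda>\<close> at
      \<open>\<epsilon> / m ^ k\<close> and \<open>\<epsilon> / m ^ Suc k\<close>, the power of the
      point cancels and the factor \<open>d\<close> is seen to be \<open>m ^ n\<close> in the
      limit.\<close>
    define \<epsilon> where "\<epsilon> = complex_of_real (r / (2 * \<mu>))"
    have \<epsilon>: "\<epsilon> \<noteq> 0" using g(2) \<mu> by (simp add: \<epsilon>_def)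
    have "\<forall>\<^sub>F k in sequentially. complex_of_real d * g (\<epsilon> / m ^ Suc k) = m ^ n * g (\<epsilon> / m ^ k)"
    proof -
      have "\<forall>\<^sub>F k in sequentially. dist (\<epsilon> / m ^ k) 0 < r" using tendstoD[OF pow g(2)] .
      moreover have "\<forall>\<^sub>F k in sequentially. dist (\<epsilon> / m ^ Suc k) 0 < r"
        using tendstoD[OF LIMSEQ_Suc[OF pow] g(2)] .
      ultimately show ?thesis
      proof eventually_elim
        case (elim k)
        have 1: "\<Lambda> (\<epsilon> / m ^ k) = (\<epsilon> / m ^ k) ^ n * g (\<epsilon> / m ^ k)"
          using g(4)[of "\<epsilon> / m ^ k"] elim by simp
        have 2: "\<Lambda> (\<epsilon> / m ^ Suc k) = (\<epsilon> / m ^ Suc k) ^ n * g (\<epsilon> / m ^ Suc k)"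
          using g(4)[of "\<epsilon> / m ^ Suc k"] elim by simp
        have "\<Lambda> (\<epsilon> / m ^ k) = complex_of_real d * \<Lambda> (\<epsilon> / m ^ Suc k)"
          using hom[of "\<epsilon> / m ^ Suc k"] m(2) by (simp add: m_def)
        then have "(\<epsilon> / m ^ k) ^ n * g (\<epsilon> / m ^ k) =
            complex_of_real d * ((\<epsilon> / m ^ Suc k) ^ n * g (\<epsilon> / m ^ Suc k))"
          unfolding 1 2 .
        also have "(\<epsilon> / m ^ Suc k) ^ n = (\<epsilon> / m ^ k) ^ n / m ^ n"
          by (simp add: power_divide power_mult_distrib mult.commute)
        finally have "(\<epsilon> / m ^ k) ^ n * (m ^ n * g (\<epsilon> / m ^ k)) =
            (\<epsilon> / m ^ k) ^ n * (complex_of_real d * g (\<epsilon> / m ^ Suc k))"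
          using m(2) by (simp add: eq_divide_eq mult_ac)
        moreover have "(\<epsilon> / m ^ k) ^ n \<noteq> 0" using m(2) \<epsilon> by simp
        ultimately show ?case by (metis mult_left_cancel)
      qed
    qed
    moreover have "(\<lambda>k. complex_of_real d * g (\<epsilon> / m ^ Suc k)) \<longlonglongrightarrow> complex_of_real d * g 0"
      by (intro tendsto_mult tendsto_const LIMSEQ_Suc[OF glim])
    ultimately have "(\<lambda>k. m ^ n * g (\<epsilon> / m ^ k)) \<longlonglongrightarrow> complex_of_real d * g 0"
      by (rule Lim_transform_eventually[rotated])
    moreover have "(\<lambda>k. m ^ n * g (\<epsilon> / m ^ k)) \<longlonglongrightarrow> m ^ n * g 0"
      by (intro tendsto_mult tendsto_const glim)
    ultimately have "complex_of_real d * g 0 = m ^ n * g 0" by (rule LIMSEQ_unique)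
    then show ?thesis using g(5)[of 0] g(2) by simp
  qed
  have "\<Lambda> z = g 0 * z ^ n" for z
  proof -
    have "\<forall>\<^sub>F k in sequentially. z ^ n * g (z / m ^ k) = \<Lambda> z"
      using g_eq[of z] by eventually_elim (use m(2) in \<open>simp add: dn\<close>)
    moreover have "(\<lambda>k. z ^ n * g (z / m ^ k)) \<longlonglongrightarrow> z ^ n * g 0"
      by (intro tendsto_mult tendsto_const glim)
    ultimately have "(\<lambda>k. \<Lambda> z) \<longlonglongrightarrow> z ^ n * g 0" by (rule Lim_transform_eventually[rotated])
    then show ?thesis by (simp add: LIMSEQ_const_iff mult.commute)
  qed
  moreover have "d = \<mu> ^ n" using dn by (simp add: m_def flip: of_real_power)
  moreover have "g 0 \<noteq> 0" using g by simp
  ultimately show thesis using that g(1) by blast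
qed

text \<open>On the unit circle the imaginary part of the monomial is
  \<open>\<beta> * sin (n * t)\<close>. The angle \<open>pi / (2 * n)\<close> gives the sign of
  \<open>\<beta>\<close>; for \<open>n \<ge> 2\<close> the angle \<open>3 * pi / (2 * n)\<close>
  also belongs to the upper half circle, and there the sine is -1.\<close>

lemma homogeneous_entire_half_plane:
  fixes \<Lambda> :: "complex \<Rightarrow> complex" and \<mu> :: real
  assumes hol: "\<Lambda> holomorphic_on UNIV" and \<mu>: "\<mu> > 1" and d: "d > 1"
    and hom: "\<And>z. \<Lambda> (complex_of_real \<mu> * z) = complex_of_real d * \<Lambda> z"
    and nz: "\<Lambda> z1 \<noteq> 0"
    and real: "\<And>z. z \<in> \<real> \<Longrightarrow> \<Lambda> z \<in> \<real>" and pos: "\<And>z. Im z \<ge> 0 \<Longrightarrow> Im (\<Lambda> z) \<ge> 0"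
  obtains \<beta> where "\<beta> > 0" "\<mu> = d" "\<And>z. \<Lambda> z = complex_of_real \<beta> * z"
proof -
  obtain n a where na: "n > 0" "a \<noteq> 0" "d = \<mu> ^ n" "\<And>z. \<Lambda> z = a * z ^ n"
    using homogeneous_entire[OF hol \<mu> d hom nz] by metis
  have "a \<in> \<real>" using real[of 1] na(4)[of 1] by simp
  then obtain \<beta> where \<beta>: "a = complex_of_real \<beta>" by (auto elim: Reals_cases)
  have cis: "Im (\<Lambda> (cis t)) = \<beta> * sin (n * t)" for t :: real
    by (simp add: na(4) \<beta> Complex.DeMoivre)
  have n: "real n > 0" using na(1) by simp
  have "0 \<le> sin (pi / (2 * n))" using n by (intro sin_ge_zero) (auto simp: divide_le_eq)
  then have "0 \<le> Im (\<Lambda> (cis (pi / (2 * n))))" by (intro pos) simp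
  then have b0: "\<beta> \<ge> 0" unfolding cis using n by simp
  have "n = 1"
  proof (rule ccontr)
    assume "n \<noteq> 1"
    then have "real n \<ge> 2" using na(1) by simp
    then have "0 \<le> sin (3 * pi / (2 * n))"
      using mult_right_mono[of 3 "2 * real n" pi] by (intro sin_ge_zero) (auto simp: divide_le_eq mult.commute)
    then have "0 \<le> Im (\<Lambda> (cis (3 * pi / (2 * n))))" by (intro pos) simp
    then have "0 \<le> \<beta> * sin (n * (3 * pi / (2 * n)))" unfolding cis .
    moreover have "real n * (3 * pi / (2 * n)) = 3 * pi / 2" using n by simp
    ultimately have "0 \<le> \<beta> * sin (3 * pi / 2)" by (simp only:)
    moreover have "sin (3 * pi / 2) = - 1" using sin_3over2_pi by (simp add: mult.commute)
    ultimately show False using b0 na(2) \<beta> by simp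
  qed
  then show thesis using that[of \<beta>] na b0 \<beta> by simp
qed

subsection \<open>Linearizations with a half plane are exponentials\<close>

text \<open>Periodicity lets \<open>F\<close> factor through
  \<open>q = exp (- \<i> * \<beta> * z)\<close>, for which
  \<open>|q| = exp (\<beta> * Im z)\<close>. The lower half plane corresponds to small
  \<open>q\<close>, so the first bound removes the singularity at 0, and the second is linear growth
  in \<open>q\<close>. Liouville then leaves an affine function.\<close>

lemma periodic_entire_exponential:
  fixes F :: "complex \<Rightarrow> complex" and \<beta> :: real
  assumes hol: "F holomorphic_on UNIV" and \<beta>: "\<beta> > 0"
    and per: "\<And>z. F (z + complex_of_real (2 * pi / \<beta>)) = F z"
    and low: "\<And>z. Im z \<le> 0 \<Longrightarrow> cmod (F z) \<le> C"
    and up: "\<And>z. Im z \<ge> 0 \<Longrightarrow> cmod (F z) \<le> C * exp (\<beta> * Im z)"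
  obtains A b where "\<And>z. F z = A * exp (- \<i> * \<beta> * z) + b"
proof -
  define w where "w = complex_of_real (2 * pi / \<beta>)"
  have perw: "F (z + w) = F z" for z using per[of z] unfolding w_def .
  have pern: "F (z + of_nat n * w) = F z" for z n
  proof (induction n)
    case (Suc n)
    have "z + of_nat (Suc n) * w = (z + of_nat n * w) + w" by (simp add: algebra_simps)
    then show ?case by (simp only: perw Suc)
  qed simp
  have peri: "F (z + of_int n * w) = F z" for z and n :: int
  proof (cases "n \<ge> 0")
    case True
    then show ?thesis using pern[of z "nat n"] by simp
  next
    case False
    then show ?thesis using pern[of "z + of_int n * w" "nat (- n)"] by (simp add: algebra_simps)
  qed
  have Feq: "F z = F z'" if eq: "exp (- \<i> * \<beta> * z) = exp (- \<i> * \<beta> * z')" for z z'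
  proof -
    obtain n :: int where "- \<i> * \<beta> * z = - \<i> * \<beta> * z' + complex_of_real (of_int (2 * n) * pi) * \<i>"
      using eq unfolding exp_eq by auto
    then have "- \<i> * \<beta> * z = - \<i> * \<beta> * (z' + of_int (- n) * w)"
      using \<beta> by (simp add: w_def algebra_simps)
    then have "z = z' + of_int (- n) * w" using \<beta> by simp
    then show ?thesis using peri[of z' "- n"] by simp
  qed
  define P where "P q = F (\<i> * Ln q / \<beta>)" for q
  have PF: "P (exp (- \<i> * \<beta> * z)) = F z" for z
    unfolding P_def by (rule Feq) (use \<beta> in simp)
  have Pexp: "P q = F (\<i> * l / \<beta>)" if "exp l = q" for q l
    unfolding P_def by (rule Feq) (use \<beta> that in auto)
  have holP: "P holomorphic_on - {0}"
    unfolding holomorphic_on_def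
  proof
    fix q :: complex assume "q \<in> - {0}"
    then have q: "q \<noteq> 0" by simp
    \<comment> \<open>\<open>Ln\<close> jumps at the negative axis, but by \<open>Feq\<close> the
      value of \<open>P\<close> does not depend on the logarithm chosen;
      \<open>Ln (x / q) + Ln q\<close> is holomorphic on this disc.\<close>
    have nz: "x \<noteq> 0 \<and> x / q \<notin> \<real>\<^sub>\<le>\<^sub>0" if x: "x \<in> ball q (cmod q)" for x
    proof -
      have "cmod (1 - x / q) * cmod q = cmod (q - x)"
        using q by (simp add: norm_mult[symmetric] left_diff_distrib)
      also have "\<dots> < 1 * cmod q" using x by (simp add: dist_norm)
      finally have "cmod (1 - x / q) < 1" using q by simp
      then have "Re (1 - x / q) < 1" using complex_Re_le_cmod[of "1 - x / q"] by linarith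
      then show ?thesis by (auto simp: complex_nonpos_Reals_iff)
    qed
    have "F \<circ> (\<lambda>x. \<i> * (Ln (x / q) + Ln q) / \<beta>) holomorphic_on ball q (cmod q)"
      using nz \<beta> q by (intro holomorphic_on_compose_gen[OF _ hol] holomorphic_intros) auto
    moreover have "(F \<circ> (\<lambda>x. \<i> * (Ln (x / q) + Ln q) / \<beta>)) x = P x" if x: "x \<in> ball q (cmod q)" for x
      using Pexp[of "Ln (x / q) + Ln q" x] nz[OF x] q by (simp add: exp_add)
    ultimately have "P holomorphic_on ball q (cmod q)" using holomorphic_transform by blast
    then show "P field_differentiable at q within - {0}"
      using q holomorphic_on_imp_differentiable_at field_differentiable_at_within
      by (metis centre_in_ball open_ball zero_less_norm_iff)
  qed
  have Im_Ln: "Im (\<i> * Ln q / \<beta>) = ln (cmod q) / \<beta>" if "q \<noteq> 0" for q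
    using that by simp
  have "\<forall>\<^sub>F q in at (0::complex). q \<noteq> 0 \<and> dist q 0 < 1"
    by (auto simp: eventually_at intro!: exI[of _ 1])
  then have "\<forall>\<^sub>F q in at 0. cmod (P q) \<le> C"
  proof eventually_elim
    case (elim q)
    then have "Im (\<i> * Ln q / \<beta>) \<le> 0" using \<beta> by (subst Im_Ln) (auto simp: divide_le_0_iff)
    then show ?case unfolding P_def by (rule low)
  qed
  moreover have "P holomorphic_on UNIV - {0}" using holP by (simp add: Compl_eq_Diff_UNIV)
  ultimately obtain Q where Q: "Q holomorphic_on UNIV" "\<And>q. q \<noteq> 0 \<Longrightarrow> Q q = P q"
    using holomorphic_on_extend_bounded[of P UNIV 0] by auto
  have grow: "cmod (Q q) \<le> C * cmod q ^ 1" if q: "1 \<le> cmod q" for q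
  proof -
    have q0: "q \<noteq> 0" using q by auto
    have "Im (\<i> * Ln q / \<beta>) \<ge> 0" using \<beta> q by (subst Im_Ln[OF q0]) simp
    from up[OF this] have "cmod (P q) \<le> C * exp (\<beta> * (ln (cmod q) / \<beta>))"
      unfolding P_def Im_Ln[OF q0] .
    then show ?thesis using \<beta> q0 by (simp add: Q(2))
  qed
  have lin: "Q q = Q 0 + deriv Q 0 * q" for q
    using Liouville_polynomial[OF Q(1) grow, of 1 q] by simp
  have "F z = deriv Q 0 * exp (- \<i> * \<beta> * z) + Q 0" for z
    using lin[of "exp (- \<i> * \<beta> * z)"] unfolding Q(2)[OF exp_not_eq_zero] PF
    by (simp only: add.commute)
  then show thesis using that by blast
qed

context frontier_fixed_point
begin

lemma affinely_conjugate_to_power: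
  obtains A b where "A \<noteq> 0" "\<And>w. f (A * w + b) = A * w ^ d + b"
proof -
  obtain F where F: "F holomorphic_on UNIV" "\<And>z. F (m * z) = f (F z)"
      "\<And>z. F z \<in> U \<longleftrightarrow> Im z < 0" "\<And>z. F z \<in> K \<longleftrightarrow> Im z \<le> 0"
    using linearization_half_plane by metis
  obtain B c M R where B: "c \<in> U" "M > 0" "continuous_on (- U) B" "B holomorphic_on (- K)"
    "\<And>w. w \<notin> U \<Longrightarrow> B (f w) = B w ^ d"
    "\<And>w. w \<notin> U \<Longrightarrow> 1 \<le> cmod (B w)" "\<And>w. w \<notin> U \<Longrightarrow> w \<in> K \<Longrightarrow> cmod (B w) = 1"
    "\<And>w. w \<notin> U \<Longrightarrow> cmod (w - c) \<le> M * cmod (B w)" "\<And>w. w \<notin> U \<Longrightarrow> cmod (B w) \<le> M * cmod (w - c)"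
    "inj_on B {w. R < cmod (w - c)}"
    by (rule boettcher_function) blast
  define \<mu> where "\<mu> = cmod m"
  have \<mu>: "\<mu> > 1" "m = complex_of_real \<mu>"
    using multiplier_gt_1 multiplier_pos by (auto simp: \<mu>_def)
  have d1: "real d > 1" using degree_ge_2 by simp
  define H where "H = {z. 0 \<le> Im z}"
  have convH: "convex H" unfolding H_def by (rule convex_halfspace_Im_ge)
  have openI: "open {z. 0 < Im z}" by (rule open_halfspace_Im_gt)
  define G where "G z = B (F z)" for z
  have contG: "continuous_on H G" unfolding G_def
    by (rule continuous_on_compose2[OF B(3) holomorphic_on_imp_continuous_on[OF holomorphic_on_subset[OF F(1)]]])
       (auto simp: F H_def)
  have "B \<circ> F holomorphic_on {z. 0 < Im z}"
    by (rule holomorphic_on_compose_gen[OF holomorphic_on_subset[OF F(1)] B(4)]) (auto simp: F)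
  then have holG: "G holomorphic_on {z. 0 < Im z}" by (simp add: o_def G_def[abs_def])
  have G1: "1 \<le> cmod (G z)" if "z \<in> H" for z using that by (auto simp: G_def H_def F B)
  have Greal: "cmod (G z) = 1" if "Im z = 0" for z using that by (auto simp: G_def F B)
  have Gm: "G (m * z) = G z ^ d" if "z \<in> H" for z
    using that by (simp add: G_def F B H_def)
  obtain L0 where L0: "continuous_on H L0" "\<And>z. z \<in> H \<Longrightarrow> G z = exp (L0 z)"
    using continuous_logarithm_on_contractible[OF contG convex_imp_contractible[OF convH]] G1
    by (metis norm_zero not_one_le_zero)
  have holL0: "L0 holomorphic_on {z. 0 < Im z}"
    by (rule continuous_log_imp_holomorphic[OF openI continuous_on_subset[OF L0(1)] holG L0(2)])
       (auto simp: H_def)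
  have mH: "m * z \<in> H" if "z \<in> H" for z using that \<mu> by (simp add: H_def)
  \<comment> \<open>The exponential of this difference is 1, so its values are integer multiples of
    \<open>2 * pi * \<i>\<close>, and continuity on the connected set \<open>H\<close> makes it
    constant.\<close>
  have "(\<lambda>z. L0 (m * z) - of_nat d * L0 z) constant_on H"
  proof (rule continuous_discrete_range_constant)
    show "connected H" using convH by (rule convex_connected)
    show "continuous_on H (\<lambda>z. L0 (m * z) - of_nat d * L0 z)"
      by (intro continuous_intros L0(1) continuous_on_compose2[OF L0(1)]) (auto intro: mH)
    have one: "exp (L0 (m * z) - of_nat d * L0 z) = 1" if z: "z \<in> H" for z
      using Gm[OF z] L0(2)[OF z] L0(2)[OF mH[OF z]] by (simp add: exp_diff exp_of_nat_mult)
    show "\<exists>e>0. \<forall>y. y \<in> H \<and> L0 (m * y) - of_nat d * L0 y \<noteq> L0 (m * z) - of_nat d * L0 z \<longrightarrow>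
        e \<le> cmod (L0 (m * y) - of_nat d * L0 y - (L0 (m * z) - of_nat d * L0 z))" if z: "z \<in> H" for z
    proof (intro exI[of _ "2 * pi"] conjI allI impI)
      fix y assume y: "y \<in> H \<and> L0 (m * y) - of_nat d * L0 y \<noteq> L0 (m * z) - of_nat d * L0 z"
      define D where "D = L0 (m * y) - of_nat d * L0 y - (L0 (m * z) - of_nat d * L0 z)"
      have "exp D = 1" using one[OF z] one y unfolding D_def by (subst exp_diff) simp
      then obtain n :: int where n: "Re D = 0" "Im D = of_int (2 * n) * pi" by (auto simp: exp_eq_1)
      have "D \<noteq> 0" using y by (simp add: D_def)
      then have "n \<noteq> 0" using n by (auto simp: complex_eq_iff)
      then have "1 \<le> \<bar>real_of_int n\<bar>" by linarith
      then have "2 * pi \<le> \<bar>Im D\<bar>" using n by (simp add: abs_mult)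
      then show "2 * pi \<le> cmod (L0 (m * y) - of_nat d * L0 y - (L0 (m * z) - of_nat d * L0 z))"
        using abs_Im_le_cmod[of D] unfolding D_def by linarith
    qed simp
  qed
  then obtain k where k: "\<And>z. z \<in> H \<Longrightarrow> L0 (m * z) - of_nat d * L0 z = k"
    unfolding constant_on_def by blast
  \<comment> \<open>Subtracting the value at the fixed point 0 of multiplication by \<open>m\<close>
    removes the constant \<open>k\<close> from the functional equation.\<close>
  define L where "L z = L0 z - L0 0" for z
  have H0: "0 \<in> H" by (simp add: H_def)
  have Lm: "L (m * z) = of_nat d * L z" if z: "z \<in> H" for z
    using k[OF z] k[OF H0] by (simp add: L_def algebra_simps)
  have GL: "G z = G 0 * exp (L z)" if z: "z \<in> H" for z
    using L0(2)[OF z] L0(2)[OF H0] by (simp add: L_def exp_diff)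
  have ReL: "exp (Re (L z)) = cmod (G z)" if z: "z \<in> H" for z
    using arg_cong[OF GL[OF z], of cmod] Greal[of 0] by (simp add: norm_mult)
  \<comment> \<open>On \<open>H\<close> the imaginary part of \<open>\<i> * L\<close> is
    \<open>log |G| \<ge> 0\<close>. It vanishes on the real line, where \<open>F\<close> lands on
    the frontier of \<open>U\<close>, and this permits the reflection.\<close>
  define \<Lambda> where "\<Lambda> z = (if 0 \<le> Im z then \<i> * L z else cnj (\<i> * L (cnj z)))" for z
  have ReL0: "Re (L z) = 0" if "Im z = 0" for z
    using ReL[of z] that Greal[OF that] by (simp add: H_def)
  have hol\<Lambda>: "\<Lambda> holomorphic_on UNIV" unfolding \<Lambda>_def
  proof (rule Schwarz_reflection)
    show "(\<lambda>z. \<i> * L z) holomorphic_on UNIV \<inter> {z. 0 < Im z}"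
      unfolding L_def by (intro holomorphic_intros) (simp add: holL0)
    show "continuous_on (UNIV \<inter> {z. 0 \<le> Im z}) (\<lambda>z. \<i> * L z)"
      unfolding L_def using L0(1) by (intro continuous_intros) (simp add: H_def)
    show "\<i> * L z \<in> \<real>" if "z \<in> \<real>" for z
      using ReL0[of z] that by (simp add: complex_is_Real_iff)
  qed auto
  have hom: "\<Lambda> (complex_of_real \<mu> * z) = complex_of_real (real d) * \<Lambda> z" for z
  proof (cases "0 \<le> Im z")
    case True
    then show ?thesis using Lm[of z] \<mu> by (simp add: \<Lambda>_def H_def zero_le_mult_iff)
  next
    case False
    then have "cnj z \<in> H" by (simp add: H_def)
    moreover have "\<not> 0 \<le> \<mu> * Im z" using False \<mu>(1) by (simp add: zero_le_mult_iff)
    ultimately show ?thesis using Lm[of "cnj z"] False \<mu> by (simp add: \<Lambda>_def)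
  qed
  obtain b0 where b0: "\<And>z. z \<in> K \<Longrightarrow> cmod z \<le> b0" "b0 > 0" using K_bounded by metis
  have lowF: "cmod (F z) \<le> b0" if "Im z \<le> 0" for z using that b0(1) F(4) by blast
  have upF: "cmod (F z) \<le> cmod c + M * cmod (G z)" if "z \<in> H" for z
  proof -
    have "cmod (F z - c) \<le> M * cmod (G z)" unfolding G_def
      using that by (intro B(8)) (simp add: F H_def)
    then show ?thesis using norm_triangle_ineq2[of "F z" c] by linarith
  qed
  have "F (- \<i>) \<in> U" "F \<i> \<notin> U" by (auto simp: F)
  then have nconst: "F (- \<i>) \<noteq> F \<i>" by auto
  \<comment> \<open>Otherwise \<open>|G| = 1\<close> on \<open>H\<close>, so \<open>F\<close> is
    bounded on both half planes and constant by Liouville.\<close>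
  have "\<exists>z. \<Lambda> z \<noteq> 0"
  proof (rule ccontr)
    assume "\<nexists>z. \<Lambda> z \<noteq> 0"
    then have "cmod (G z) = 1" if "z \<in> H" for z
      using ReL[OF that] that by (auto simp: \<Lambda>_def H_def dest!: spec[of _ z])
    then have "cmod (F z) \<le> max b0 (cmod c + M)" for z
      using lowF[of z] upF[of z] by (cases "Im z \<le> 0") (auto simp: H_def)
    then have "bounded (range F)" by (auto simp: bounded_iff)
    from Liouville_theorem[OF F(1) this] show False
      using nconst by (auto simp: constant_on_def)
  qed
  then obtain z1 where z1: "\<Lambda> z1 \<noteq> 0" by blast
  obtain \<beta> where \<beta>: "\<beta> > 0" "\<mu> = d" "\<And>z. \<Lambda> z = complex_of_real \<beta> * z"
  proof (rule homogeneous_entire_half_plane[OF hol\<Lambda> \<mu>(1) d1 hom z1])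
    show "\<Lambda> z \<in> \<real>" if "z \<in> \<real>" for z
      using ReL0[of z] that by (simp add: complex_is_Real_iff \<Lambda>_def)
    show "0 \<le> Im (\<Lambda> z)" if "0 \<le> Im z" for z
    proof -
      have "1 \<le> exp (Re (L z))" using that ReL[of z] G1[of z] by (simp add: H_def)
      then show ?thesis using that by (simp add: \<Lambda>_def)
    qed
  qed blast
  have GE: "G z = G 0 * exp (- \<i> * \<beta> * z)" if z: "z \<in> H" for z
  proof -
    have "\<i> * L z = \<beta> * z" using \<beta>(3)[of z] z by (simp add: \<Lambda>_def H_def)
    then have "L z = - \<i> * (\<beta> * z)" by (metis complex_i_mult_minus minus_mult_left minus_minus)
    then show ?thesis using GL[OF z] by (simp add: mult.assoc)
  qed
  have Gnorm: "cmod (G z) = exp (\<beta> * Im z)" if z: "z \<in> H" for z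
    unfolding GE[OF z] norm_mult using Greal[of 0] by simp
  define w where "w = complex_of_real (2 * pi / \<beta>)"
  \<comment> \<open>\<open>G\<close> has period \<open>w\<close> on \<open>H\<close>, so
    \<open>B\<close> takes the same value at \<open>F (z + w)\<close> and \<open>F z\<close>. High
    up both points are where \<open>B\<close> is injective, and the identity theorem does the
    rest.\<close>
  have per: "F (z + w) = F z" for z
  proof (rule analytic_continuation_open[where f = "\<lambda>z. F (z + w)" and g = F and s' = UNIV])
    \<comment> \<open>Above this height \<open>|G z| = exp (\<beta> * Im z)\<close> exceeds
      \<open>M * (\<bar>R\<bar> + 1)\<close>, which keeps \<open>F z\<close> farther than
      \<open>R\<close> from \<open>c\<close>; the maximum with 0 keeps \<open>z\<close> in
      \<open>H\<close>.\<close>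
    define Y where "Y = max 0 (ln (M * (\<bar>R\<bar> + 1)) / \<beta>)"
    show "open {z. Im z > Y}" by (rule open_halfspace_Im_gt)
    have "\<i> * complex_of_real (Y + 1) \<in> {z. Im z > Y}" by simp
    then show "{z. Im z > Y} \<noteq> {}" by blast
    show "(\<lambda>z. F (z + w)) holomorphic_on UNIV"
    proof -
      have "(\<lambda>z. z + w) holomorphic_on UNIV" by (intro holomorphic_intros)
      from holomorphic_on_compose_gen[OF this F(1)] show ?thesis by (simp add: o_def)
    qed
    fix z assume "z \<in> {z. Im z > Y}"
    then have z: "Im z > Y" by simp
    then have zH: "z \<in> H" "z + w \<in> H" by (auto simp: H_def Y_def w_def)
    have far: "R < cmod (F v - c)" if v: "v \<in> H" "Im v > Y" for v
    proof -
      have "ln (M * (\<bar>R\<bar> + 1)) / \<beta> < Im v" using v(2) by (simp add: Y_def)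
      then have "ln (M * (\<bar>R\<bar> + 1)) < \<beta> * Im v" using \<beta>(1) by (simp add: divide_less_eq mult.commute)
      then have "exp (ln (M * (\<bar>R\<bar> + 1))) < exp (\<beta> * Im v)" by simp
      then have "M * (\<bar>R\<bar> + 1) < cmod (G v)" using B(2) Gnorm[OF v(1)] by (simp add: add_nonneg_pos)
      also have "\<dots> \<le> M * cmod (F v - c)" unfolding G_def
        using v(1) by (intro B(9)) (simp add: F H_def)
      finally have "\<bar>R\<bar> + 1 < cmod (F v - c)" using B(2) by simp
      then show ?thesis by linarith
    qed
    have "exp (- \<i> * \<beta> * w) = 1" using \<beta>(1) by (simp add: w_def exp_eq_1 exI[of _ "-1"])
    moreover have "exp (- \<i> * \<beta> * (z + w)) = exp (- \<i> * \<beta> * z) * exp (- \<i> * \<beta> * w)"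
      unfolding exp_add[symmetric] by (simp add: algebra_simps)
    ultimately have "G (z + w) = G z" unfolding GE[OF zH(1)] GE[OF zH(2)] by (simp only: mult_1_right)
    then have "B (F (z + w)) = B (F z)" by (simp add: G_def)
    moreover have "R < cmod (F (z + w) - c)" using zH z by (intro far) (auto simp: w_def)
    moreover have "R < cmod (F z - c)" using zH z by (intro far)
    ultimately show "F (z + w) = F z" using inj_onD[OF B(10)] by blast
  qed (auto simp: F)
  define C where "C = b0 + cmod c + M"
  obtain A b where AF: "\<And>z. F z = A * exp (- \<i> * \<beta> * z) + b"
  proof (rule periodic_entire_exponential[OF F(1) \<beta>(1)])
    show "F (z + complex_of_real (2 * pi / \<beta>)) = F z" for z using per[of z] unfolding w_def .
    show "cmod (F z) \<le> C" if "Im z \<le> 0" for z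
      using lowF[OF that] B(2) by (simp add: C_def add_increasing2)
    show "cmod (F z) \<le> C * exp (\<beta> * Im z)" if z: "0 \<le> Im z" for z
    proof -
      have "1 \<le> exp (\<beta> * Im z)" using z \<beta>(1) by simp
      then have "(b0 + cmod c) * 1 \<le> (b0 + cmod c) * exp (\<beta> * Im z)"
        using b0(2) by (intro mult_left_mono) auto
      then show ?thesis using upF[of z] Gnorm[of z] z b0(2)
        by (simp add: C_def H_def algebra_simps)
    qed
  qed blast
  show thesis
  proof (rule that[of A b])
    show "A \<noteq> 0" using nconst AF by auto
    \<comment> \<open>In the coordinate \<open>q = exp (- \<i> * \<beta> * z)\<close>,
      multiplication of \<open>z\<close> by \<open>m = d\<close> is the \<open>d\<close>-th power.
      The exponential omits \<open>q = 0\<close>, which is reached afterwards by continuity.\<close>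
    have nz: "f (A * q + b) = A * q ^ d + b" if q: "q \<noteq> 0" for q
    proof -
      define z where "z = \<i> * Ln q / \<beta>"
      have ez: "exp (- \<i> * \<beta> * z) = q" using q \<beta>(1) by (simp add: z_def)
      have "f (A * q + b) = F (m * z)" using F(2)[of z] by (simp only: AF ez)
      also have "\<dots> = A * exp (of_nat d * (- \<i> * \<beta> * z)) + b"
        using \<mu>(2) \<beta>(2) by (simp add: AF mult_ac)
      finally show ?thesis by (simp only: exp_of_nat_mult ez)
    qed
    have "closed {q. f (A * q + b) = A * q ^ d + b}"
      by (intro closed_Collect_eq continuous_intros)
    moreover have "- {0} \<subseteq> {q. f (A * q + b) = A * q ^ d + b}" using nz by auto
    ultimately have "closure (- {0}) \<subseteq> {q. f (A * q + b) = A * q ^ d + b}"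
      by (rule closure_minimal[rotated])
    moreover have "closure (- {0::complex}) = UNIV" by (simp add: closure_interior)
    ultimately show "f (A * q + b) = A * q ^ d + b" for q by auto
  qed
qed

end

theorem mainTheorem7:
  fixes p :: "complex poly" and d :: nat
  assumes "degree p = d" and "d \<ge> 2"
    and "poly p -` (convex hull (julia_set p)) = convex hull (julia_set p)"
    and "convex hull (julia_set p) = filled_julia_set p"
    and "interior (convex hull (julia_set p)) \<noteq> {}"
  shows "\<exists>a b c :: complex. a \<noteq> 0 \<and> cmod c = 1 \<and>
           (\<forall>z. poly p z = (c * (a * z + b) ^ d - b) / a)"
proof -
  define K where "K = convex hull (julia_set p)"
  interpret convex_filled_julia p K
  proof unfold_locales
    show "degree p \<ge> 2" using assms(1,2) by simp
    show "K = filled_julia_set p" using assms(4) by (simp only: K_def)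
    show "convex K" by (simp only: K_def convex_convex_hull)
    show "interior K \<noteq> {}" using assms(5) unfolding K_def .
  qed
  obtain z0 where "z0 \<in> K" "z0 \<notin> interior K" "poly p z0 = z0"
    by (rule frontier_fixed_point) blast
  then interpret frontier_fixed_point p K z0 by unfold_locales
  obtain A b where A: "A \<noteq> 0" "\<And>w. poly p (A * w + b) = A * w ^ degree p + b"
    by (rule affinely_conjugate_to_power) blast
  \<comment> \<open>The conjugating map is the inverse of \<open>w \<mapsto> A * w + b\<close>. The
    unimodular constant is 1 because the exponential coordinate turns
    \<open>F (m z) = f (F z)\<close> into the pure power.\<close>
  have "poly p z = (1 * (1 / A * z + - b / A) ^ d - - b / A) / (1 / A)" for z
  proof -
    have "poly p z = poly p (A * ((z - b) / A) + b)" using A(1) by simp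
    also have "\<dots> = A * ((z - b) / A) ^ d + b" unfolding A(2) by (simp only: assms(1))
    also have "(z - b) / A = 1 / A * z + - b / A" by (simp add: diff_divide_distrib)
    also have "A * x + b = (1 * x - - b / A) / (1 / A)" for x using A(1) by (simp add: distrib_right)
    finally show ?thesis .
  qed
  then show ?thesis using A(1)
    by (intro exI[of _ "1 / A"] exI[of _ "- b / A"] exI[of _ 1]) auto
qed

end
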